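(* Let $k\in\{1,\ldots,n-1\}$, $0<\alpha\leq 1$ and $\lambda,\delta,M>0$. Set $\varepsilon_0(k):=2^k\,240^{-k-1}$ and $$C:=\frac{20^{n+1}\,2n\,M\lambda}{\delta\,\omega_n},\qquad r_1:=\big(4\lambda(2+4^{1+\alpha})+8C\big)^{-1/\alpha}.$$ Let $E\subset\mathbb{R}^n$ be a Borel set such that for every $x\in E$ $$\delta r^k\leq\mathcal{H}^k(E\cap B(x,r))\leq Mr^k\quad\text{for every }0<r\leq\mathrm{diam}(E).$$ Suppose moreover that for every $x\in E$ there exists a linear $k$-plane $V_x\subset\mathbb{R}^n$ such that $$\mathcal{H}^k\big((E\cap B(x,r))\setminus Q_\alpha(x,V_x,\lambda)\big)<\varepsilon_0(k)\,\delta\, r^k\quad\text{for every }0<r\leq\mathrm{diam}(E).$$ Suppose in addition that $\mathrm{diam}(E)\leq r_1$. Then $E$ can be covered by one $k$-dimensional graph of a $C^{1,\alpha}$ map.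
   Context: $B(x,r)$ is the closed Euclidean ball of center $x$ and radius $r$ in $\mathbb{R}^n$, and $\omega_n$ is the Lebesgue measure of the unit ball of $\mathbb{R}^n$. $\mathcal{H}^k$ is the $k$-dimensional Hausdorff measure with no normalizing factor: $\mathcal{H}^k(E)=\lim_{\delta\to0}\inf\{\sum_i \mathrm{diam}(E_i)^k: E\subset\bigcup_i E_i,\ \mathrm{diam}(E_i)\le\delta\}$. For a linear subspace $V$, $P_V$ is the orthogonal projection onto $V$. For a linear $k$-plane $V$, $\lambda>0$ and $x\in\mathbb{R}^n$, the $\alpha$-paraboloid is $$Q_\alpha(x,V,\lambda):=\{y\in\mathbb{R}^n: |P_{V^\perp}(y-x)|\le\lambda|P_V(y-x)|^{1+\alpha}\}.$$ A $k$-dimensional graph of a $C^{1,\alpha}$ map is a set $\{v+f(v):v\in V\}$, where $V$ is a linear $k$-plane of $\mathbb{R}^n$ and $f:V\to V^\perp$ is $C^1$ with $\alpha$-Hölder derivative. *)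

theory Defs
  imports "HOL-Analysis.Analysis"
begin

subsection \<open>Hausdorff measure without normalizing factor\<close>

(* The library's diameter is only meaningful on bounded sets (it is the real supremum of the
   distances), so "diam (A i) <= d" is written with an explicit boundedness condition.
   Finite covers are included by padding with empty sets, which contribute 0 when k >= 1;
   for k = 0 they would contribute 0 ^ 0 = 1, so the definition is meant for k >= 1 only. *)
definition hausdorff_pre :: "nat \<Rightarrow> real \<Rightarrow> 'a::metric_space set \<Rightarrow> ennreal" where
  "hausdorff_pre k d S =
     (INF A \<in> {A :: nat \<Rightarrow> 'a set. S \<subseteq> (\<Union>i. A i) \<and> (\<forall>i. bounded (A i) \<and> diameter (A i) \<le> d)}.
        (\<Sum>i. ennreal (diameter (A i) ^ k)))"

definition hausdorff_measure :: "nat \<Rightarrow> 'a::metric_space set \<Rightarrow> ennreal" where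
  "hausdorff_measure k S = Lim (at_right 0) (\<lambda>d. hausdorff_pre k d S)"

lemma hausdorff_pre_antimono: "d \<le> e \<Longrightarrow> hausdorff_pre k e S \<le> hausdorff_pre k d S"
  unfolding hausdorff_pre_def by (rule INF_superset_mono) (auto intro: order_trans)

lemma tendsto_hausdorff_pre_SUP:
  "((\<lambda>d. hausdorff_pre k d S) \<longlongrightarrow> (SUP d\<in>{0<..}. hausdorff_pre k d S)) (at_right 0)"
proof (rule order_tendstoI)
  fix a assume "a < (SUP d\<in>{0<..}. hausdorff_pre k d S)"
  then obtain e where e: "e > 0" "a < hausdorff_pre k e S"
    by (auto simp: less_SUP_iff)
  then have "a < hausdorff_pre k d S" if "d \<in> {0<..<e}" for d
    using that hausdorff_pre_antimono[of d e k S] by (auto intro: less_le_trans)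
  then show "eventually (\<lambda>d. a < hausdorff_pre k d S) (at_right 0)"
    by (rule eventually_at_rightI) (use e in auto)
next
  fix a assume a: "(SUP d\<in>{0<..}. hausdorff_pre k d S) < a"
  have "hausdorff_pre k d S < a" if "d \<in> {0<..<1}" for d
    by (rule le_less_trans[OF SUP_upper a]) (use that in auto)
  then show "eventually (\<lambda>d. hausdorff_pre k d S < a) (at_right 0)"
    by (rule eventually_at_rightI) auto
qed

lemma hausdorff_measure_eq_SUP:
  "hausdorff_measure k S = (SUP d\<in>{0<..}. hausdorff_pre k d S)"
  unfolding hausdorff_measure_def
  by (rule tendsto_Lim[OF _ tendsto_hausdorff_pre_SUP]) simp

lemma tendsto_hausdorff_measure:
  "((\<lambda>d. hausdorff_pre k d S) \<longlongrightarrow> hausdorff_measure k S) (at_right 0)"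
  unfolding hausdorff_measure_eq_SUP by (rule tendsto_hausdorff_pre_SUP)


subsection \<open>Planes, orthogonal projections and paraboloids\<close>

definition linear_plane :: "nat \<Rightarrow> 'a::euclidean_space set \<Rightarrow> bool" where
  "linear_plane k V \<longleftrightarrow> subspace V \<and> dim V = k"

definition orth_proj :: "'a::euclidean_space set \<Rightarrow> 'a \<Rightarrow> 'a" where
  "orth_proj V x = (THE p. p \<in> V \<and> x - p \<in> orthogonal_comp V)"

lemma orth_proj_ex1:
  fixes V :: "'a::euclidean_space set"
  assumes "subspace V"
  shows "\<exists>!p. p \<in> V \<and> x - p \<in> orthogonal_comp V"
proof (rule ex_ex1I)
  have sp: "span V = V" using assms by simp
  obtain y z where "y \<in> span V" "\<And>w. w \<in> span V \<Longrightarrow> orthogonal z w" "x = y + z"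
    using orthogonal_subspace_decomp_exists by blast
  then show "\<exists>p. p \<in> V \<and> x - p \<in> orthogonal_comp V"
    by (intro exI[of _ y]) (auto simp: sp orthogonal_comp_def orthogonal_commute)
next
  fix p q
  assume p: "p \<in> V \<and> x - p \<in> orthogonal_comp V" and q: "q \<in> V \<and> x - q \<in> orthogonal_comp V"
  have "p - q \<in> V"
    using assms p q by (simp add: subspace_diff)
  moreover have "(x - q) - (x - p) \<in> orthogonal_comp V"
    by (rule subspace_diff[OF subspace_orthogonal_comp]) (use p q in auto)
  then have "p - q \<in> orthogonal_comp V" by simp
  ultimately have "orthogonal (p - q) (p - q)"
    by (simp add: orthogonal_comp_def)
  then show "p = q" by (simp add: orthogonal_self)
qed

lemma orth_proj:
  assumes "subspace V"
  shows "orth_proj V x \<in> V" "x - orth_proj V x \<in> orthogonal_comp V"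
  using theI'[OF orth_proj_ex1[OF assms]] unfolding orth_proj_def by auto

definition paraboloid :: "real \<Rightarrow> 'a::euclidean_space \<Rightarrow> 'a set \<Rightarrow> real \<Rightarrow> 'a set" where
  "paraboloid \<alpha> x V lam =
     {y. norm (orth_proj (orthogonal_comp V) (y - x)) \<le> lam * norm (orth_proj V (y - x)) powr (1 + \<alpha>)}"


subsection \<open>Graphs of maps with Hoelder continuous derivative\<close>

(* The derivative at a point of V is a linear map on V. It is represented here by a bounded linear
   map f' x on the whole space, of which only the restriction to V is determined by f. Since f' is
   existentially quantified, this amounts to using operator norms on V: restriction to V does not
   increase norms, and conversely a linear map on V extends to the whole space with the same norm
   by precomposition with the orthogonal projection onto V. *)
definition C1_holder_on :: "real \<Rightarrow> 'a::euclidean_space set \<Rightarrow> ('a \<Rightarrow> 'b::real_normed_vector) \<Rightarrow> bool" where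
  "C1_holder_on \<alpha> V f \<longleftrightarrow>
     (\<exists>f' :: 'a \<Rightarrow> 'a \<Rightarrow>\<^sub>L 'b.
        (\<forall>x\<in>V. (f has_derivative blinfun_apply (f' x)) (at x within V)) \<and>
        continuous_on V f' \<and>
        (\<exists>K. \<forall>x\<in>V. \<forall>y\<in>V. norm (f' x - f' y) \<le> K * dist x y powr \<alpha>))"

definition C1_holder_graph :: "nat \<Rightarrow> real \<Rightarrow> 'a::euclidean_space set \<Rightarrow> bool" where
  "C1_holder_graph k \<alpha> G \<longleftrightarrow>
     (\<exists>V f. linear_plane k V \<and> f ` V \<subseteq> orthogonal_comp V \<and> C1_holder_on \<alpha> V f \<and>
            G = {v + f v | v. v \<in> V})"

end

theory Submission
  imports Defs
begin

text \<open>
  Let \<open>x \<noteq> y\<close> be points of \<open>E\<close> and \<open>r = dist x y\<close>. By the density bounds, at least half of the mass of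
  \<open>E\<close> in \<open>cball x r\<close> lies in both paraboloids, that is, in two slabs of width \<open>lam * r powr (1 + \<alpha>)\<close>.
  If \<open>V x\<close> and \<open>V y\<close> formed a large angle, the intersection of the slabs would be a thin neighbourhood
  of a \<open>(k - 1)\<close>-plane, and a packing estimate would contradict the lower density bound. Hence the
  angle is at most a constant times \<open>r powr \<alpha>\<close>, and the distance of \<open>y\<close> from \<open>x + V x\<close> is at most a
  constant times \<open>r powr (1 + \<alpha>)\<close>. Since the diameter of \<open>E\<close> is small, \<open>E\<close> is then a Lipschitz graph
  over one of the planes, and the planes provide a Whitney jet for it.

  Whitney extension needs no partition of unity: the supremum of all functions below the upper
  envelopes \<open>f a + L a (x - a) + M * norm (x - a) powr (1 + \<alpha>)\<close> whose second differences are at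
  least \<open>- 2 * M * norm v powr (1 + \<alpha>)\<close> has second differences of this size on both sides,
  and locally bounded functions with such second differences are \<open>C\<close>-one with \<open>\<alpha>\<close>-Hoelder derivative.
\<close>

section \<open>Functions with small second differences\<close>

text \<open>The factor \<open>1 / 2 ^ j\<close> is what a difference quotient at scale
  \<open>1 / 2 ^ j\<close> cancels; what remains is geometric in \<open>j\<close>, with ratio below
  1 when \<alpha> is positive.\<close>

lemma dyadic_powr:
  "(1 / 2 ^ Suc j) powr (1 + \<alpha>) = 1 / 2 ^ j * (2 powr (- \<alpha>)) ^ j * (2 powr (- \<alpha>) / 2 :: real)"
proof -
  have e: "1 / 2 ^ i = (2::real) powr (- real i)" for i :: nat
    by (simp only: powr_minus powr_realpow[OF zero_less_numeral] divide_inverse mult_1)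
  have f: "(2 powr (- \<alpha>)) ^ j = (2::real) powr (- \<alpha> * real j)"
    by (simp only: powr_powr[symmetric] powr_realpow powr_gt_zero)
  have g: "1 / 2 = (2::real) powr (- 1)" by (simp add: powr_minus_divide)
  have "(1 / 2 ^ Suc j) powr (1 + \<alpha>) = (2::real) powr (- real (Suc j) * (1 + \<alpha>))"
    unfolding e by (simp only: powr_powr)
  also have "- real (Suc j) * (1 + \<alpha>) = - real j + - \<alpha> * real j + (- \<alpha> + - 1)"
    by (simp add: algebra_simps)
  also have "(2::real) powr \<dots> = 1 / 2 ^ j * (2 powr (- \<alpha>)) ^ j * (2 powr (- \<alpha>) * (1 / 2))"
    unfolding e f g by (simp only: powr_add)
  finally show ?thesis by simp
qed

text \<open>Halving the step changes the difference quotient by \<open>2 ^ j\<close> times a second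
  difference centred at the midpoint, hence by a geometrically small amount, so the quotients
  converge. The quotient for \<open>j = 0\<close> is the full increment
  \<open>F (x + v) - F x\<close>, and the same series bounds its distance from the limit.\<close>

lemma dyadic_derivative:
  fixes F :: "'a::real_normed_vector \<Rightarrow> 'b::banach"
  assumes "0 < \<alpha>"
    and sd: "\<And>x v. norm (F (x + v) + F (x - v) - 2 *\<^sub>R F x) \<le> C * norm v powr (1 + \<alpha>)"
  obtains T where "(\<lambda>j. 2 ^ j *\<^sub>R (F (x + (1 / 2 ^ j) *\<^sub>R v) - F x)) \<longlonglongrightarrow> T"
    and "norm (F (x + v) - F x - T) \<le> C / (1 - 2 powr (- \<alpha>)) * norm v powr (1 + \<alpha>)"
proof -
  define a where "a = (\<lambda>j::nat. 2 ^ j *\<^sub>R (F (x + (1 / 2 ^ j) *\<^sub>R v) - F x))"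
  define q :: real where "q = 2 powr (- \<alpha>)"
  have q: "0 < q" "q < 1" using assms(1) by (auto simp: q_def powr_less_one)
  define D where "D = C * norm v powr (1 + \<alpha>)"
  have "0 \<le> D" using sd[of 0 v] norm_ge_zero order_trans unfolding D_def by blast
  have step: "norm (a (Suc j) - a j) \<le> D * q ^ j" for j
  proof -
    define w where "w = (1 / 2 ^ Suc j) *\<^sub>R v"
    have w2: "w + w = (1 / 2 ^ j) *\<^sub>R v"
      by (simp add: w_def scaleR_add_left[symmetric])
    have "a (Suc j) = 2 ^ j *\<^sub>R (2 *\<^sub>R (F (x + w) - F x))"
      by (simp add: a_def w_def)
    moreover have "a j = 2 ^ j *\<^sub>R (F (x + w + w) - F x)"
      by (simp only: a_def w2 add.assoc)
    ultimately have "a (Suc j) - a j = 2 ^ j *\<^sub>R (2 *\<^sub>R (F (x + w) - F x) - (F (x + w + w) - F x))"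
      by (simp only: scaleR_diff_right)
    also have "2 *\<^sub>R (F (x + w) - F x) - (F (x + w + w) - F x)
        = - (F ((x + w) + w) + F ((x + w) - w) - 2 *\<^sub>R F (x + w))"
      by (simp add: scaleR_2)
    finally have "a (Suc j) - a j
        = 2 ^ j *\<^sub>R - (F ((x + w) + w) + F ((x + w) - w) - 2 *\<^sub>R F (x + w))" .
    then have "norm (a (Suc j) - a j) \<le> 2 ^ j * (C * norm w powr (1 + \<alpha>))"
      using mult_left_mono[OF sd[of "x + w" w], of "2 ^ j"]
      by (simp only: norm_scaleR norm_minus_cancel) simp
    also have "norm w powr (1 + \<alpha>) = (1 / 2 ^ Suc j) powr (1 + \<alpha>) * norm v powr (1 + \<alpha>)"
      unfolding w_def by (simp add: powr_mult powr_divide)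
    also have "(1 / 2 ^ Suc j) powr (1 + \<alpha>) = (1 / 2 ^ j) * q ^ j * (q / 2)"
      unfolding q_def by (rule dyadic_powr)
    also have "2 ^ j * (C * (1 / 2 ^ j * q ^ j * (q / 2) * norm v powr (1 + \<alpha>))) = D * q ^ j * (q / 2)"
      by (simp add: D_def)
    also have "\<dots> \<le> D * q ^ j * 1"
      using q \<open>0 \<le> D\<close> by (intro mult_left_mono) auto
    finally show ?thesis by simp
  qed
  have geo: "(\<lambda>j. D * q ^ j) sums (D * (1 / (1 - q)))"
    using q by (intro sums_mult geometric_sums) auto
  have sm: "summable (\<lambda>j. norm (a (Suc j) - a j))"
    by (rule summable_comparison_test[OF _ sums_summable[OF geo]]) (use step in auto)
  define S where "S = (\<Sum>j. a (Suc j) - a j)"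
  have "(\<lambda>n. \<Sum>j<n. a (Suc j) - a j) \<longlonglongrightarrow> S"
    unfolding S_def by (rule summable_LIMSEQ[OF summable_norm_cancel[OF sm]])
  then have "(\<lambda>n. a n - a 0) \<longlonglongrightarrow> S"
    by (simp add: sum_lessThan_telescope)
  from tendsto_add[OF this tendsto_const[of "a 0"]] have "a \<longlonglongrightarrow> a 0 + S"
    by (simp add: add.commute)
  moreover have "norm S \<le> D * (1 / (1 - q))"
    using summable_norm[OF sm] suminf_le[OF step sm sums_summable[OF geo]] sums_unique[OF geo]
    unfolding S_def by simp
  then have "norm (F (x + v) - F x - (a 0 + S)) \<le> C / (1 - q) * norm v powr (1 + \<alpha>)"
    by (simp add: a_def D_def)
  ultimately show ?thesis
    using that unfolding a_def q_def by blast
qed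

lemma norm_diff_le_add:
  fixes a b :: "'a::real_normed_vector"
  shows "norm a \<le> r \<Longrightarrow> norm b \<le> s \<Longrightarrow> norm (a - b) \<le> r + s"
  using norm_triangle_ineq4[of a b] by linarith

text \<open>Additive maps commute with integer multiples. Splitting \<open>real N * c\<close> into
  integer and fractional part shows that \<open>N\<close> times the defect of homogeneity is bounded
  independently of \<open>N\<close>, so the defect vanishes.\<close>

lemma additive_bounded_imp_linear:
  fixes T :: "'a::real_normed_vector \<Rightarrow> 'b::real_normed_vector"
  assumes add: "\<And>u v. T (u + v) = T u + T v"
    and bd: "\<And>v. \<exists>B. \<forall>s\<in>{0..1}. norm (T (s *\<^sub>R v)) \<le> B"
  shows "linear T"
proof (rule linearI)
  show "T (u + v) = T u + T v" for u v by (rule add)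
next
  fix c :: real and v
  interpret additive T by standard (rule add)
  have nat: "T (real m *\<^sub>R u) = real m *\<^sub>R T u" for m u
    by (induction m) (simp_all add: zero add scaleR_add_left)
  have int: "T (real_of_int m *\<^sub>R u) = real_of_int m *\<^sub>R T u" for m u
  proof (cases "m \<ge> 0")
    case True
    then show ?thesis using nat[of "nat m" u] by simp
  next
    case False
    then show ?thesis using nat[of "nat (- m)" u] by (simp add: minus)
  qed
  obtain B where B: "\<And>s. s \<in> {0..1} \<Longrightarrow> norm (T (s *\<^sub>R v)) \<le> B" using bd[of v] by blast
  have bound: "real N * norm (T (c *\<^sub>R v) - c *\<^sub>R T v) \<le> B + norm (T v)" for N
  proof -
    define s where "s = frac (real N * c)"
    define m where "m = \<lfloor>real N * c\<rfloor>"
    have Nc: "real N * c = of_int m + s" by (simp add: s_def m_def frac_def)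
    have s: "s \<in> {0..1}" by (simp add: s_def frac_lt_1 less_imp_le)
    have "real N *\<^sub>R T (c *\<^sub>R v) = T ((real N * c) *\<^sub>R v)"
      using nat[of N "c *\<^sub>R v"] by simp
    also have "\<dots> = of_int m *\<^sub>R T v + T (s *\<^sub>R v)"
      unfolding Nc scaleR_add_left add int ..
    finally have "real N *\<^sub>R (T (c *\<^sub>R v) - c *\<^sub>R T v) = T (s *\<^sub>R v) - s *\<^sub>R T v"
      using Nc by (simp add: scaleR_diff_right scaleR_add_left)
    then have "real N * norm (T (c *\<^sub>R v) - c *\<^sub>R T v) = norm (T (s *\<^sub>R v) - s *\<^sub>R T v)"
      by (metis abs_of_nat norm_scaleR)
    also have "\<dots> \<le> norm (T (s *\<^sub>R v)) + norm (s *\<^sub>R T v)" by (rule norm_triangle_ineq4)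
    also have "\<dots> \<le> B + 1 * norm (T v)"
      using B[OF s] s unfolding norm_scaleR by (intro add_mono mult_right_mono) auto
    finally show ?thesis by simp
  qed
  show "T (c *\<^sub>R v) = c *\<^sub>R T v"
  proof (rule ccontr)
    assume "T (c *\<^sub>R v) \<noteq> c *\<^sub>R T v"
    then have "norm (T (c *\<^sub>R v) - c *\<^sub>R T v) > 0" by simp
    from reals_Archimedean3[OF this] show False
      using bound by (meson not_le)
  qed
qed

text \<open>The limits \<open>T x\<close> of the dyadic quotients are additive, because the defect
  is a limit of rescaled second differences, and bounded on segments, because \<open>F\<close> is
  locally bounded; hence they are linear. The error of order \<open>1 + \<alpha>\<close> makes
  \<open>T x\<close> the derivative, and a comparison on a parallelogram gives its Hoelder
  continuity.\<close>

lemma C1_holder_on_second_difference: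
  fixes F :: "'a::euclidean_space \<Rightarrow> 'b::banach"
  assumes "0 < \<alpha>"
    and sd: "\<And>x v. norm (F (x + v) + F (x - v) - 2 *\<^sub>R F x) \<le> C * norm v powr (1 + \<alpha>)"
    and bdd: "\<And>R. bounded (F ` cball 0 R)"
  shows "C1_holder_on \<alpha> S F"
proof -
  define K where "K = C / (1 - 2 powr (- \<alpha>))"
  define P where "P x v t \<longleftrightarrow> (\<lambda>j. 2 ^ j *\<^sub>R (F (x + (1 / 2 ^ j) *\<^sub>R v) - F x)) \<longlonglongrightarrow> t
      \<and> norm (F (x + v) - F x - t) \<le> K * norm v powr (1 + \<alpha>)" for x v t
  have "\<exists>t. P x v t" for x v
    by (rule dyadic_derivative[of \<alpha> F C x v, OF assms(1) sd]) (auto simp: P_def K_def)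
  then obtain T where T: "\<And>x v. P x v (T x v)" by metis
  have lim: "(\<lambda>j. 2 ^ j *\<^sub>R (F (x + (1 / 2 ^ j) *\<^sub>R v) - F x)) \<longlonglongrightarrow> T x v"
    and err: "norm (F (x + v) - F x - T x v) \<le> K * norm v powr (1 + \<alpha>)" for x v
    using T[of x v] by (auto simp: P_def)
  \<comment> \<open>At a unit vector the two right-hand sides are \<open>C\<close> and
    \<open>K\<close> themselves, which are therefore nonnegative.\<close>
  obtain b0 :: 'a where b0: "norm b0 = 1" using norm_Basis[OF SOME_Basis] ..
  have C0: "0 \<le> C"
    using order_trans[OF norm_ge_zero sd[of 0 b0]] b0 by simp
  have K0: "0 \<le> K"
    using order_trans[OF norm_ge_zero err[of 0 b0]] b0 by simp
  have lin: "linear (T x)" for x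
  proof (rule additive_bounded_imp_linear)
    fix u v :: 'a
    define q :: real where "q = 2 powr (- \<alpha>)"
    have q: "0 < q" "q < 1" using assms(1) by (auto simp: q_def powr_less_one)
    define A where "A = (\<lambda>v j. 2 ^ j *\<^sub>R (F (x + (1 / 2 ^ j) *\<^sub>R v) - F x))"
    \<comment> \<open>The quotient for \<open>u + v\<close> is taken one scale finer: its base point
      is then the midpoint of the points used for \<open>u\<close> and \<open>v\<close>, and the
      defect is a second difference.\<close>
    have est: "norm (A u j + A v j - A (u + v) (Suc j)) \<le> C * norm (u - v) powr (1 + \<alpha>) * q ^ j" for j
    proof -
      define w where "w = (1 / 2 ^ Suc j) *\<^sub>R (u - v)"
      define m where "m = x + (1 / 2 ^ Suc j) *\<^sub>R (u + v)"
      have half: "(1 / 2 ^ j) *\<^sub>R z = (1 / 2 ^ Suc j) *\<^sub>R z + (1 / 2 ^ Suc j) *\<^sub>R z" for z :: 'a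
        by (simp add: scaleR_add_left[symmetric])
      have mw: "m + w = x + (1 / 2 ^ j) *\<^sub>R u" "m - w = x + (1 / 2 ^ j) *\<^sub>R v"
        unfolding m_def w_def half by (simp_all add: algebra_simps)
      have "A (u + v) (Suc j) = 2 ^ j *\<^sub>R (2 *\<^sub>R (F m - F x))"
        by (simp add: A_def m_def)
      moreover have "A u j = 2 ^ j *\<^sub>R (F (m + w) - F x)" "A v j = 2 ^ j *\<^sub>R (F (m - w) - F x)"
        by (simp_all only: A_def mw)
      ultimately have "A u j + A v j - A (u + v) (Suc j)
          = 2 ^ j *\<^sub>R ((F (m + w) - F x) + (F (m - w) - F x) - 2 *\<^sub>R (F m - F x))"
        by (simp only: scaleR_add_right scaleR_diff_right)
      also have "(F (m + w) - F x) + (F (m - w) - F x) - 2 *\<^sub>R (F m - F x)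
          = F (m + w) + F (m - w) - 2 *\<^sub>R F m"
        by (simp add: scaleR_2)
      finally have "A u j + A v j - A (u + v) (Suc j)
          = 2 ^ j *\<^sub>R (F (m + w) + F (m - w) - 2 *\<^sub>R F m)" .
      then have "norm (A u j + A v j - A (u + v) (Suc j)) \<le> 2 ^ j * (C * norm w powr (1 + \<alpha>))"
        using mult_left_mono[OF sd[of m w], of "2 ^ j"] by simp
      also have "\<dots> = C * norm (u - v) powr (1 + \<alpha>) * (2 ^ j * (1 / 2 ^ Suc j) powr (1 + \<alpha>))"
        unfolding w_def by (simp add: powr_mult powr_divide)
      also have "2 ^ j * (1 / 2 ^ Suc j) powr (1 + \<alpha>) = q ^ j * (q / 2)"
        unfolding q_def dyadic_powr by simp
      also have "C * norm (u - v) powr (1 + \<alpha>) * (q ^ j * (q / 2))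
          \<le> C * norm (u - v) powr (1 + \<alpha>) * (q ^ j * 1)"
        using q C0 by (intro mult_left_mono) auto
      finally show ?thesis by simp
    qed
    have "(\<lambda>j. C * norm (u - v) powr (1 + \<alpha>) * q ^ j) \<longlonglongrightarrow> C * norm (u - v) powr (1 + \<alpha>) * 0"
      using q by (intro tendsto_mult_left LIMSEQ_realpow_zero) auto
    then have "(\<lambda>j. A u j + A v j - A (u + v) (Suc j)) \<longlonglongrightarrow> 0"
      by (intro Lim_null_comparison[OF always_eventually[OF allI[OF est]]]) simp
    moreover have "(\<lambda>j. A u j + A v j - A (u + v) (Suc j)) \<longlonglongrightarrow> T x u + T x v - T x (u + v)"
      using lim unfolding A_def by (intro tendsto_intros LIMSEQ_Suc) auto
    ultimately show "T x (u + v) = T x u + T x v"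
      using LIMSEQ_unique by force
  next
    fix v :: 'a
    obtain B where "\<forall>y\<in>F ` cball 0 (norm x + norm v). norm y \<le> B"
      using bdd[of "norm x + norm v"] unfolding bounded_iff ..
    then have B: "norm (F z) \<le> B" if "norm z \<le> norm x + norm v" for z
      using that by simp
    have "norm (T x (s *\<^sub>R v)) \<le> 2 * B + K * norm v powr (1 + \<alpha>)" if "s \<in> {0..1}" for s
    proof -
      have sv: "norm (s *\<^sub>R v) \<le> norm v" using that by (simp add: mult_left_le_one_le)
      have "norm (F (x + s *\<^sub>R v)) \<le> B"
        by (rule B) (use sv norm_triangle_ineq[of x "s *\<^sub>R v"] in linarith)
      moreover have "norm (F x) \<le> B" by (rule B) simp
      moreover have "norm (s *\<^sub>R v) powr (1 + \<alpha>) \<le> norm v powr (1 + \<alpha>)"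
        using sv assms(1) by (intro powr_mono2) auto
      then have "K * norm (s *\<^sub>R v) powr (1 + \<alpha>) \<le> K * norm v powr (1 + \<alpha>)"
        using K0 by (rule mult_left_mono)
      ultimately show ?thesis
        using err[of x "s *\<^sub>R v"]
          norm_triangle_ineq4[of "F (x + s *\<^sub>R v) - F x" "F (x + s *\<^sub>R v) - F x - T x (s *\<^sub>R v)"]
          norm_triangle_ineq4[of "F (x + s *\<^sub>R v)" "F x"]
        by simp
    qed
    then show "\<exists>B. \<forall>s\<in>{0..1}. norm (T x (s *\<^sub>R v)) \<le> B" by blast
  qed
  define f' where "f' x = Blinfun (T x)" for x
  have f': "blinfun_apply (f' x) = T x" for x
    unfolding f'_def using lin[of x]
    by (simp add: bounded_linear_Blinfun_apply linear_conv_bounded_linear)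
  have der: "(F has_derivative T x) (at x within S)" for x
  proof (rule has_derivativeI_sandwich[where e = 1 and H = "\<lambda>y. K * norm (y - x) powr \<alpha>"])
    show "bounded_linear (T x)" using lin by (simp add: linear_conv_bounded_linear)
    show "norm (F y - F x - T x (y - x)) / norm (y - x) \<le> K * norm (y - x) powr \<alpha>"
      if "y \<noteq> x" for y
      using err[of x "y - x"] that by (simp add: powr_add field_simps)
    have "((\<lambda>y. norm (y - x)) \<longlongrightarrow> 0) (at x within S)"
      by (intro tendsto_norm_zero LIM_zero tendsto_ident_at)
    then have "((\<lambda>y. norm (y - x) powr \<alpha>) \<longlongrightarrow> 0) (at x within S)"
      using assms(1) by (intro tendsto_zero_powrI[OF _ tendsto_const]) auto
    then show "((\<lambda>y. K * norm (y - x) powr \<alpha>) \<longlongrightarrow> 0) (at x within S)"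
      by (rule tendsto_mult_right_zero)
  qed simp
  define H where "H = 2 * K + 2 * C"
  have hol: "norm (f' x - f' y) \<le> H * dist x y powr \<alpha>" for x y
  proof (cases "x = y")
    case True
    then show ?thesis by simp
  next
    case False
    define r where "r = dist x y"
    have r: "r > 0" using False by (simp add: r_def)
    show ?thesis
    proof (rule norm_blinfun_bound)
      show "0 \<le> H * dist x y powr \<alpha>" using K0 C0 by (simp add: H_def)
      fix v
      show "norm (blinfun_apply (f' x - f' y) v) \<le> H * dist x y powr \<alpha> * norm v"
      proof (cases "v = 0")
        case True
        then show ?thesis by (simp add: blinfun.zero_right)
      next
        case False
        \<comment> \<open>By linearity only vectors of length \<open>r = dist x y\<close> matter.
          Below, \<open>m\<close> is the centre of the parallelogram with vertices \<open>x\<close>,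
          \<open>y\<close>, \<open>y + u\<close>, \<open>x + u\<close>, and \<open>a\<close>,
          \<open>b\<close> are half its diagonals; in the difference of the two second differences
          at \<open>m\<close> the term \<open>F m\<close> cancels.\<close>
        define u where "u = (r / norm v) *\<^sub>R v"
        have u: "norm u = r" using False r by (simp add: u_def)
        define m where "m = (1 / 2) *\<^sub>R (x + y + u)"
        define a where "a = (1 / 2) *\<^sub>R (x + u - y)"
        define b where "b = (1 / 2) *\<^sub>R (y + u - x)"
        have half: "(1 / 2 :: real) *\<^sub>R z + (1 / 2) *\<^sub>R z = z" for z :: 'a
          by (simp add: scaleR_add_left[symmetric])
        have e1: "m + a = x + u" and e2: "m - a = y" and e3: "m + b = y + u" and e4: "m - b = x"
          unfolding m_def a_def b_def using half[of x] half[of y] half[of u]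
          by (simp_all add: scaleR_add_right scaleR_diff_right algebra_simps)
        have "norm a \<le> r"
          using norm_triangle_ineq[of u "x - y"] u
          by (simp add: a_def r_def dist_norm add_diff_eq add.commute)
        then have "C * norm a powr (1 + \<alpha>) \<le> C * r powr (1 + \<alpha>)"
          using C0 assms(1) by (intro mult_left_mono powr_mono2) auto
        with sd[of m a] have ea: "norm (F (x + u) + F y - 2 *\<^sub>R F m) \<le> C * r powr (1 + \<alpha>)"
          unfolding e1 e2 by linarith
        have "norm b \<le> r"
          using norm_triangle_ineq[of u "y - x"] u
          by (simp add: b_def r_def dist_norm add_diff_eq add.commute norm_minus_commute[of x y])
        then have "C * norm b powr (1 + \<alpha>) \<le> C * r powr (1 + \<alpha>)"
          using C0 assms(1) by (intro mult_left_mono powr_mono2) auto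
        with sd[of m b] have eb: "norm (F (y + u) + F x - 2 *\<^sub>R F m) \<le> C * r powr (1 + \<alpha>)"
          unfolding e3 e4 by linarith
        have "T x u - T y u = (F (x + u) + F y - 2 *\<^sub>R F m) - (F (y + u) + F x - 2 *\<^sub>R F m)
            - (F (x + u) - F x - T x u) + (F (y + u) - F y - T y u)" by simp
        also have "norm \<dots> \<le> C * r powr (1 + \<alpha>) + C * r powr (1 + \<alpha>)
            + K * r powr (1 + \<alpha>) + K * r powr (1 + \<alpha>)"
          using norm_triangle_mono[OF norm_diff_le_add[OF norm_diff_le_add[OF ea eb] err[of x u]] err[of y u]] u
          by simp
        finally have *: "norm (T x u - T y u) \<le> H * r powr \<alpha> * r"
          using r by (simp add: H_def powr_add algebra_simps)
        have "T x u - T y u = (r / norm v) *\<^sub>R (T x v - T y v)"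
          unfolding u_def by (simp add: linear_scale[OF lin] scaleR_diff_right)
        then have "norm (T x u - T y u) = r / norm v * norm (T x v - T y v)"
          using r by simp
        with * have "r / norm v * norm (T x v - T y v) \<le> H * r powr \<alpha> * r" by simp
        then have "norm (T x v - T y v) \<le> H * r powr \<alpha> * norm v"
          using False r by (simp add: field_simps)
        then show ?thesis
          using r by (simp add: f' blinfun.diff_left r_def)
      qed
    qed
  qed
  have "continuous_on S f'"
  proof (unfold continuous_on_def, intro ballI)
    fix x
    have "((\<lambda>y. dist y x) \<longlongrightarrow> 0) (at x within S)"
      using tendsto_ident_at[of x S] by (rule tendsto_dist_iff[THEN iffD1])
    then have "((\<lambda>y. dist y x powr \<alpha>) \<longlongrightarrow> 0) (at x within S)"
      using assms(1) by (intro tendsto_zero_powrI[OF _ tendsto_const]) auto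
    then have "((\<lambda>y. H * dist y x powr \<alpha>) \<longlongrightarrow> 0) (at x within S)"
      by (rule tendsto_mult_right_zero)
    then have "((\<lambda>y. f' y - f' x) \<longlongrightarrow> 0) (at x within S)"
      by (rule Lim_null_comparison[rotated]) (use hol in auto)
    then show "(f' \<longlongrightarrow> f' x) (at x within S)" by (rule LIM_zero_cancel)
  qed
  then show ?thesis
    unfolding C1_holder_on_def using der hol by (auto simp: f' intro!: exI[of _ f'])
qed

section \<open>Whitney extension\<close>

text \<open>After division by \<open>a + b\<close> both terms lie in the unit interval, where
  \<open>t \<le> t powr s\<close>.\<close>

lemma powr_add_le_add_powr:
  fixes a b :: real
  assumes "0 \<le> a" "0 \<le> b" "0 < s" "s \<le> 1"
  shows "(a + b) powr s \<le> a powr s + b powr s"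
proof (cases "a + b = 0")
  case True
  then have "a = 0" "b = 0" using assms by linarith+
  then show ?thesis by simp
next
  case False
  then have c: "0 < a + b" using assms by linarith
  have le: "t \<le> t powr s" if "0 \<le> t" "t \<le> 1" for t :: real
    using powr_mono'[OF assms(4) that] that by simp
  have "1 = a / (a + b) + b / (a + b)"
    using c by (simp add: add_divide_distrib[symmetric])
  also have "\<dots> \<le> (a / (a + b)) powr s + (b / (a + b)) powr s"
    using assms c by (intro add_mono le) (auto simp: field_simps)
  also have "\<dots> = (a powr s + b powr s) / (a + b) powr s"
    using assms c by (simp add: powr_divide add_divide_distrib)
  finally show ?thesis using c by (simp add: field_simps)
qed

text \<open>The parallelogram law is the case \<open>p = 2\<close>. For smaller exponents, concavity
  of \<open>t powr (p / 2)\<close> bounds the sum by twice the power of the mean, which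
  subadditivity then splits.\<close>

lemma norm_powr_second_difference:
  fixes x v :: "'a::real_inner"
  assumes "0 < p" "p \<le> 2"
  shows "norm (x + v) powr p + norm (x - v) powr p \<le> 2 * norm x powr p + 2 * norm v powr p"
proof -
  define s where "s = p / 2"
  have s: "0 < s" "s \<le> 1" using assms by (auto simp: s_def)
  have sq: "norm z powr p = ((norm z)\<^sup>2) powr s" for z :: 'a
    by (simp add: s_def power2_eq_square powr_mult powr_add[symmetric])
  define a where "a = (norm (x + v))\<^sup>2"
  define b where "b = (norm (x - v))\<^sup>2"
  have par: "a + b = 2 * ((norm x)\<^sup>2 + (norm v)\<^sup>2)"
    unfolding a_def b_def power2_norm_eq_inner
    by (simp add: inner_add_left inner_add_right inner_diff_left inner_diff_right inner_commute)
  have "a powr s + b powr s \<le> 2 * ((a + b) / 2) powr s"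
  proof -
    have ab: "0 \<le> a" "0 \<le> b" by (simp_all add: a_def b_def)
    show ?thesis
    proof (cases "a + b = 0")
      case True
      then have "a = 0" "b = 0" using ab by linarith+
      then show ?thesis by simp
    next
      case False
      define c where "c = (a + b) / 2"
      have c: "0 < c" using ab False by (simp add: c_def)
      \<comment> \<open>the tangent line of the concave function \<open>t powr s\<close> at \<open>t = 1\<close>\<close>
      have tangent: "t powr s \<le> 1 + s * (t - 1)" if "0 \<le> t" for t :: real
        using Youngs_inequality_0[of s "1 - s" t 1] that s by (cases "t = 0") (auto simp: algebra_simps)
      have "(a / c) powr s + (b / c) powr s \<le> 2 + s * ((a + b) / c - 2)"
        using tangent[of "a / c"] tangent[of "b / c"] ab c by (simp add: add_divide_distrib algebra_simps)
      also have "(a + b) / c = 2" using c by (simp add: c_def field_simps)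
      finally have "(a powr s + b powr s) / c powr s \<le> 2"
        using ab c by (simp add: powr_divide add_divide_distrib)
      then show ?thesis using c by (simp add: c_def field_simps)
    qed
  qed
  also have "(a + b) / 2 = (norm x)\<^sup>2 + (norm v)\<^sup>2" by (simp add: par)
  also have "2 * ((norm x)\<^sup>2 + (norm v)\<^sup>2) powr s \<le> 2 * (((norm x)\<^sup>2) powr s + ((norm v)\<^sup>2) powr s)"
    using s by (intro mult_left_mono powr_add_le_add_powr) auto
  finally show ?thesis by (simp add: sq a_def b_def)
qed

text \<open>A Perron construction between the lower envelopes \<open>m a\<close> and the upper
  envelopes \<open>q a\<close>, which touch at \<open>a\<close> with value \<open>f a\<close>. Since
  \<alpha> \<le> 1, the exponent \<open>p\<close> is at most 2, so the envelopes themselves have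
  controlled second differences on one side.\<close>

lemma whitney_C1_alpha_extension_real:
  fixes f :: "'a::euclidean_space \<Rightarrow> real" and L :: "'a \<Rightarrow> 'a \<Rightarrow> real"
  assumes \<alpha>: "0 < \<alpha>" "\<alpha> \<le> 1" and "0 \<le> K"
    and lin: "\<And>a. a \<in> A \<Longrightarrow> linear (L a)"
    and jet0: "\<And>a b. a \<in> A \<Longrightarrow> b \<in> A \<Longrightarrow> \<bar>f b - f a - L a (b - a)\<bar> \<le> K * norm (b - a) powr (1 + \<alpha>)"
    and jet1: "\<And>a b v. a \<in> A \<Longrightarrow> b \<in> A \<Longrightarrow> \<bar>L b v - L a v\<bar> \<le> K * norm (b - a) powr \<alpha> * norm v"
  shows "\<exists>F M. (\<forall>a\<in>A. F a = f a) \<and>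
    (\<forall>x v. \<bar>F (x + v) + F (x - v) - 2 * F x\<bar> \<le> M * norm v powr (1 + \<alpha>)) \<and>
    (\<forall>R. bounded (F ` cball 0 R))"
proof (cases "A = {}")
  case True
  then show ?thesis by (intro exI[of _ "\<lambda>_. 0"] exI[of _ 0]) (auto simp: image_constant_conv)
next
  case False
  then obtain a0 where a0: "a0 \<in> A" by blast
  define p where "p = 1 + \<alpha>"
  have p: "0 < p" "p \<le> 2" using \<alpha> by (auto simp: p_def)
  \<comment> \<open>Comparing two jets costs at most \<open>4 * K + 2 * K\<close> at the relevant
    scale, which \<open>8 * K\<close> dominates.\<close>
  define M where "M = 8 * K"
  have M: "0 \<le> M" using assms by (simp add: M_def)
  define q where "q a x = f a + L a (x - a) + M * norm (x - a) powr p" for a x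
  define m where "m a x = f a + L a (x - a) - M * norm (x - a) powr p" for a x
  have semi: "M * norm (x + v - a) powr p + M * norm (x - v - a) powr p
      \<le> 2 * (M * norm (x - a) powr p) + 2 * (M * norm v powr p)" for a x v :: 'a
  proof -
    have "x + v - a = x - a + v" "x - v - a = x - a - v" by simp_all
    then show ?thesis
      using mult_left_mono[OF norm_powr_second_difference[OF p, of "x - a" v] M]
      by (simp only: distrib_left mult.left_commute[of M 2] mult.assoc)
  qed
  have L_split: "L a (x + v - a) = L a (x - a) + L a v" "L a (x - v - a) = L a (x - a) - L a v"
    if "a \<in> A" for a x v
  proof -
    have "x + v - a = x - a + v" "x - v - a = x - a - v" by simp_all
    then show "L a (x + v - a) = L a (x - a) + L a v" "L a (x - v - a) = L a (x - a) - L a v"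
      by (simp_all only: linear_add[OF lin[OF that]] linear_diff[OF lin[OF that]])
  qed
  have q_semi: "q a (x + v) + q a (x - v) \<le> 2 * q a x + 2 * (M * norm v powr p)" if "a \<in> A" for a x v
    using semi[of x v a] unfolding q_def L_split[OF that] distrib_left by linarith
  have m_semi: "m a (x + v) + m a (x - v) \<ge> 2 * m a x - 2 * (M * norm v powr p)" if "a \<in> A" for a x v
    using semi[of x v a] unfolding m_def L_split[OF that] distrib_left right_diff_distrib by linarith
  \<comment> \<open>With \<open>s\<close> the larger of the distances from \<open>x\<close> to
    \<open>a\<close> and \<open>b\<close>, the two base points are at most \<open>2 * s\<close>
    apart, so the affine parts differ at \<open>x\<close> by at most \<open>M * s powr p\<close>. As
    \<open>s\<close> is one of the two distances, the power terms of the envelopes absorb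
    this.\<close>
  have m_le_q: "m b x \<le> q a x" if ab: "a \<in> A" "b \<in> A" for a b x
  proof -
    define s where "s = max (norm (x - a)) (norm (x - b))"
    have s: "0 \<le> s" by (simp add: s_def le_max_iff_disj)
    have "norm (b - a) \<le> 2 * s"
      using norm_triangle_ineq4[of "x - a" "x - b"] by (simp add: s_def)
    then have pa: "norm (b - a) powr \<alpha> \<le> 2 * s powr \<alpha>"
    proof -
      have "norm (b - a) powr \<alpha> \<le> (2 * s) powr \<alpha>"
        using \<open>norm (b - a) \<le> 2 * s\<close> \<alpha> by (intro powr_mono2) auto
      also have "\<dots> = 2 powr \<alpha> * s powr \<alpha>" by (simp add: powr_mult s)
      also have "2 powr \<alpha> \<le> (2::real) powr 1" using \<alpha> by (intro powr_mono) auto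
      finally show ?thesis by (simp add: mult_right_mono)
    qed
    have pp: "t powr p = t powr \<alpha> * t" if "0 \<le> t" for t :: real
      using that by (cases "t = 0") (simp_all add: p_def powr_add)
    have "norm (b - a) powr p \<le> 2 * s powr \<alpha> * (2 * s)"
      unfolding pp[OF norm_ge_zero] using pa \<open>norm (b - a) \<le> 2 * s\<close> s by (intro mult_mono) auto
    then have j0: "\<bar>f b - f a - L a (b - a)\<bar> \<le> K * (4 * s powr p)"
      using order_trans[OF jet0[OF ab] mult_left_mono[OF _ \<open>0 \<le> K\<close>]] s by (simp add: pp p_def[symmetric])
    have "K * (norm (b - a) powr \<alpha> * norm (x - b)) \<le> K * (2 * s powr \<alpha> * s)"
      using pa s \<open>0 \<le> K\<close> by (intro mult_left_mono mult_mono) (auto simp: s_def)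
    then have j1: "\<bar>L b (x - b) - L a (x - b)\<bar> \<le> K * (2 * s powr p)"
      using jet1[OF ab, of "x - b"] s by (simp add: pp mult.assoc)
    have "L a (x - a) = L a (x - b) + L a (b - a)"
      using linear_add[OF lin[OF ab(1)], of "x - b" "b - a"] by simp
    then have "f b + L b (x - b) - (f a + L a (x - a)) \<le> M * s powr p"
      using j0 j1 \<open>0 \<le> K\<close> mult_nonneg_nonneg[OF \<open>0 \<le> K\<close> powr_ge_zero[of s p]]
      unfolding M_def by (simp add: abs_le_iff)
    also have "M * s powr p \<le> M * (norm (x - a) powr p + norm (x - b) powr p)"
      using M by (intro mult_left_mono) (auto simp: s_def max_def)
    finally show ?thesis by (simp add: m_def q_def algebra_simps)
  qed
  \<comment> \<open>The upper barrier makes the pointwise supremum finite, and a lower bound on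
    second differences passes to suprema. The lower envelopes belong to the family, so it is
    nonempty and its supremum is at least \<open>f a\<close> at \<open>a\<close>.\<close>
  define P where "P = {h :: 'a \<Rightarrow> real. (\<forall>a\<in>A. \<forall>x. h x \<le> q a x) \<and>
      (\<forall>x v. h (x + v) + h (x - v) \<ge> 2 * h x - 2 * (M * norm v powr p))}"
  define F where "F x = (SUP h\<in>P. h x)" for x
  have mP: "m a \<in> P" if "a \<in> A" for a
    using m_le_q m_semi that by (auto simp: P_def)
  have bdd: "bdd_above ((\<lambda>h. h x) ` P)" for x
    using a0 by (intro bdd_aboveI[of _ "q a0 x"]) (auto simp: P_def)
  have upper: "h x \<le> F x" if "h \<in> P" for h x
    unfolding F_def using that by (intro cSUP_upper bdd)
  have least: "F x \<le> z" if "\<And>h. h \<in> P \<Longrightarrow> h x \<le> z" for x z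
    unfolding F_def using mP[OF a0] that by (intro cSUP_least) auto
  have F_q: "F x \<le> q a x" if "a \<in> A" for a x
    by (rule least) (use that in \<open>auto simp: P_def\<close>)
  have F_low: "F (x + v) + F (x - v) \<ge> 2 * F x - 2 * (M * norm v powr p)" for x v
  proof -
    have "F x \<le> (F (x + v) + F (x - v) + 2 * (M * norm v powr p)) / 2"
    proof (rule least)
      fix h assume h: "h \<in> P"
      then have "h (x + v) + h (x - v) \<ge> 2 * h x - 2 * (M * norm v powr p)" by (auto simp: P_def)
      then show "h x \<le> (F (x + v) + F (x - v) + 2 * (M * norm v powr p)) / 2"
        using upper[OF h, of "x + v"] upper[OF h, of "x - v"] by simp
    qed
    then show ?thesis by simp
  qed
  \<comment> \<open>The average of two translates of \<open>F\<close> is itself a competitor in the supremum defining \<open>F\<close>.\<close>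
  have F_up: "F (x + v) + F (x - v) \<le> 2 * F x + 2 * (M * norm v powr p)" for x v
  proof -
    define k where "k y = (F (y + v) + F (y - v)) / 2 - M * norm v powr p" for y
    have "k \<in> P"
      unfolding P_def
    proof (intro CollectI conjI ballI allI)
      fix a y assume a: "a \<in> A"
      show "k y \<le> q a y"
        using F_q[OF a, of "y + v"] F_q[OF a, of "y - v"] q_semi[OF a, of y v]
        unfolding k_def by argo
    next
      fix y w
      have "y + v + w = y + w + v" "y - v + w = y + w - v" "y + v - w = y - w + v" "y - v - w = y - w - v"
        by simp_all
      then show "2 * k y - 2 * (M * norm w powr p) \<le> k (y + w) + k (y - w)"
        using F_low[of "y + v" w] F_low[of "y - v" w] unfolding k_def by (simp only:) argo
    qed
    from upper[OF this, of x] show ?thesis unfolding k_def by argo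
  qed
  have "F a = f a" if "a \<in> A" for a
  proof (rule antisym)
    have "q a a = f a" "m a a = f a"
      using linear_0[OF lin[OF that]] by (simp_all add: q_def m_def)
    then show "F a \<le> f a" "f a \<le> F a"
      using F_q[OF that, of a] upper[OF mP[OF that], of a] by simp_all
  qed
  moreover have "\<bar>F (x + v) + F (x - v) - 2 * F x\<bar> \<le> 2 * M * norm v powr (1 + \<alpha>)" for x v
    using F_low[of x v] F_up[of x v] by (simp add: p_def abs_le_iff)
  moreover have "bounded (F ` cball 0 R)" for R
  proof -
    obtain B where B: "\<And>x. norm (L a0 x) \<le> B * norm x" and "0 < B"
      using linear_bounded_pos[OF lin[OF a0]] by blast
    define Z where "Z = \<bar>f a0\<bar> + B * (R + norm a0) + M * (R + norm a0) powr p"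
    have "norm (F x) \<le> Z" if "norm x \<le> R" for x
    proof -
      have n: "norm (x - a0) \<le> R + norm a0" using norm_triangle_ineq4[of x a0] that by linarith
      have "\<bar>L a0 (x - a0)\<bar> \<le> B * (R + norm a0)"
        using order_trans[OF B[of "x - a0"] mult_left_mono[OF n]] \<open>0 < B\<close> by simp
      moreover have "M * norm (x - a0) powr p \<le> M * (R + norm a0) powr p"
        using n p M by (intro mult_left_mono powr_mono2) auto
      ultimately show ?thesis
        using F_q[OF a0, of x] upper[OF mP[OF a0], of x] unfolding q_def m_def Z_def by auto
    qed
    then show ?thesis unfolding bounded_iff by (intro exI[of _ Z]) auto
  qed
  ultimately show ?thesis by (intro exI[of _ F] exI[of _ "2 * M"]) blast
qed

text \<open>The real-valued case is applied to each coordinate; the constants add up because the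
  norm is at most the sum of the absolute coordinates.\<close>

lemma whitney_C1_alpha_extension:
  fixes f :: "'a::euclidean_space \<Rightarrow> 'b::euclidean_space" and L :: "'a \<Rightarrow> 'a \<Rightarrow> 'b"
  assumes \<alpha>: "0 < \<alpha>" "\<alpha> \<le> 1" and "0 \<le> K"
    and lin: "\<And>a. a \<in> A \<Longrightarrow> linear (L a)"
    and jet0: "\<And>a b. a \<in> A \<Longrightarrow> b \<in> A \<Longrightarrow> norm (f b - f a - L a (b - a)) \<le> K * norm (b - a) powr (1 + \<alpha>)"
    and jet1: "\<And>a b v. a \<in> A \<Longrightarrow> b \<in> A \<Longrightarrow> norm (L b v - L a v) \<le> K * norm (b - a) powr \<alpha> * norm v"
  obtains F M where "\<And>a. a \<in> A \<Longrightarrow> F a = f a"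
    and "\<And>x v. norm (F (x + v) + F (x - v) - 2 *\<^sub>R F x) \<le> M * norm v powr (1 + \<alpha>)"
    and "\<And>R. bounded (F ` cball 0 R)"
proof -
  define P where "P i F M \<longleftrightarrow> (\<forall>a\<in>A. F a = f a \<bullet> i) \<and>
    (\<forall>x v. \<bar>F (x + v) + F (x - v) - 2 * F x\<bar> \<le> M * norm v powr (1 + \<alpha>)) \<and>
    (\<forall>R. bounded (F ` cball 0 R))" for i :: 'b and F :: "'a \<Rightarrow> real" and M :: real
  have "\<exists>F M. P i F M" if i: "i \<in> Basis" for i
    unfolding P_def
  proof (rule whitney_C1_alpha_extension_real[OF \<alpha> \<open>0 \<le> K\<close>, of A "\<lambda>a v. L a v \<bullet> i"])
    show "linear (\<lambda>v. L a v \<bullet> i)" if "a \<in> A" for a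
      using lin[OF that] by (simp add: linear_iff inner_add_left)
    show "\<bar>f b \<bullet> i - f a \<bullet> i - L a (b - a) \<bullet> i\<bar> \<le> K * norm (b - a) powr (1 + \<alpha>)"
      if "a \<in> A" "b \<in> A" for a b
      using order_trans[OF Basis_le_norm[OF i] jet0[OF that]] by (simp add: inner_diff_left)
    show "\<bar>L b v \<bullet> i - L a v \<bullet> i\<bar> \<le> K * norm (b - a) powr \<alpha> * norm v"
      if "a \<in> A" "b \<in> A" for a b v
      using order_trans[OF Basis_le_norm[OF i] jet1[OF that]] by (simp add: inner_diff_left)
  qed
  then obtain F M where FM: "\<And>i. i \<in> Basis \<Longrightarrow> P i (F i) (M i)" by metis
  define FF where "FF x = (\<Sum>i\<in>Basis. F i x *\<^sub>R i)" for x
  have comp: "FF x \<bullet> i = F i x" if "i \<in> Basis" for x i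
    using that by (simp add: FF_def)
  show thesis
  proof
    show "FF a = f a" if "a \<in> A" for a
      by (rule euclidean_eqI) (use FM that in \<open>simp add: comp P_def\<close>)
    show "norm (FF (x + v) + FF (x - v) - 2 *\<^sub>R FF x) \<le> (\<Sum>i\<in>Basis. M i) * norm v powr (1 + \<alpha>)" for x v
    proof -
      have "norm (FF (x + v) + FF (x - v) - 2 *\<^sub>R FF x)
          \<le> (\<Sum>i\<in>Basis. \<bar>(FF (x + v) + FF (x - v) - 2 *\<^sub>R FF x) \<bullet> i\<bar>)"
        by (rule norm_le_l1)
      also have "\<dots> \<le> (\<Sum>i\<in>Basis. M i * norm v powr (1 + \<alpha>))"
        using FM by (intro sum_mono) (simp add: inner_add_left inner_diff_left comp P_def)
      finally show ?thesis by (simp add: sum_distrib_right)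
    qed
    show "bounded (FF ` cball 0 R)" for R
    proof -
      have "\<exists>B. \<forall>x\<in>cball 0 R. \<bar>F i x\<bar> \<le> B" if "i \<in> Basis" for i
        using FM[OF that] by (auto simp: P_def bounded_iff)
      then obtain B where B: "\<And>i x. i \<in> Basis \<Longrightarrow> x \<in> cball 0 R \<Longrightarrow> \<bar>F i x\<bar> \<le> B i" by metis
      have "norm (FF x) \<le> (\<Sum>i\<in>Basis. B i)" if "x \<in> cball 0 R" for x
        by (rule order_trans[OF norm_le_l1 sum_mono]) (simp add: comp B[OF _ that])
      then show ?thesis unfolding bounded_iff by blast
    qed
  qed
qed

section \<open>Hausdorff measure and packing\<close>

lemma hausdorff_pre_mono: "S \<subseteq> T \<Longrightarrow> hausdorff_pre k d S \<le> hausdorff_pre k d T"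
  unfolding hausdorff_pre_def by (rule INF_superset_mono) auto

text \<open>This allows the infimum over covers to be taken for one of two sets at a time. A finite
  \<open>a\<close> can be subtracted from both sides.\<close>

lemma ennreal_le_add_INF:
  fixes x a :: ennreal
  assumes "\<And>b. b \<in> B \<Longrightarrow> x \<le> a + f b"
  shows "x \<le> a + (INF b\<in>B. f b)"
proof (cases "a = top")
  case False
  have "x - a \<le> (INF b\<in>B. f b)"
    using assms False by (intro INF_greatest) (simp add: ennreal_minus_le_iff)
  then show ?thesis using False by (simp add: ennreal_minus_le_iff)
qed simp

text \<open>A cover of \<open>S\<close> and one of \<open>T\<close>, interleaved over even and odd
  indices, cover the union; grouping the resulting series in pairs shows that the weights add. The
  scale \<open>d\<close> is unchanged, so the inequality passes to the limit.\<close>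

lemma hausdorff_pre_Un: "hausdorff_pre k d (S \<union> T) \<le> hausdorff_pre k d S + hausdorff_pre k d T"
proof -
  define cov where "cov S = {A :: nat \<Rightarrow> 'a set. S \<subseteq> (\<Union>i. A i) \<and> (\<forall>i. bounded (A i) \<and> diameter (A i) \<le> d)}" for S
  define w where "w A = (\<Sum>i. ennreal (diameter (A i) ^ k))" for A :: "nat \<Rightarrow> 'a set"
  have pre: "hausdorff_pre k d S = (INF A\<in>cov S. w A)" for S
    by (simp add: hausdorff_pre_def cov_def w_def)
  have merge: "hausdorff_pre k d (S \<union> T) \<le> w A + w B" if A: "A \<in> cov S" and B: "B \<in> cov T" for A B
  proof -
    define D where "D n = (if even n then A (n div 2) else B (n div 2))" for n
    have D: "D (n + n) = A n" "D (Suc (n + n)) = B n" for n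
      by (simp_all add: D_def mult_2[symmetric])
    have "(\<Union>n. A n) \<union> (\<Union>n. B n) \<subseteq> (\<Union>n. D n)"
      unfolding D[symmetric] by blast
    moreover have "bounded (D n)" "diameter (D n) \<le> d" for n
      using A B unfolding cov_def by (auto simp: D_def)
    ultimately have "D \<in> cov (S \<union> T)"
      using A B unfolding cov_def by blast
    then have "hausdorff_pre k d (S \<union> T) \<le> w D" unfolding pre by (rule INF_lower)
    also have "w D = w A + w B"
    proof -
      have "(\<lambda>n. ennreal (diameter (D n) ^ k)) sums w D"
        unfolding w_def by (rule summable_sums) simp
      from sums_group[OF this, of 2]
      have "(\<lambda>n. ennreal (diameter (A n) ^ k) + ennreal (diameter (B n) ^ k)) sums w D"
        by (simp add: D numeral_2_eq_2)
      then show ?thesis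
        unfolding w_def[of A] w_def[of B] by (subst suminf_add) (simp_all add: sums_iff)
    qed
    finally show ?thesis .
  qed
  have "hausdorff_pre k d (S \<union> T) \<le> w A + hausdorff_pre k d T" if "A \<in> cov S" for A
    unfolding pre[of T] using merge[OF that] by (rule ennreal_le_add_INF)
  then have "hausdorff_pre k d (S \<union> T) \<le> hausdorff_pre k d T + w A" if "A \<in> cov S" for A
    using that by (simp add: add.commute)
  then show ?thesis
    unfolding pre[of S] add.commute[of "INF A\<in>cov S. w A"] by (rule ennreal_le_add_INF)
qed

lemma hausdorff_measure_mono: "S \<subseteq> T \<Longrightarrow> hausdorff_measure k S \<le> hausdorff_measure k T"
  unfolding hausdorff_measure_eq_SUP by (intro SUP_mono' hausdorff_pre_mono)

lemma hausdorff_measure_Un: "hausdorff_measure k (S \<union> T) \<le> hausdorff_measure k S + hausdorff_measure k T"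
  using tendsto_le[OF _ tendsto_add[OF tendsto_hausdorff_measure tendsto_hausdorff_measure]
      tendsto_hausdorff_measure always_eventually[OF allI[OF hausdorff_pre_Un]]]
  by simp

lemma hausdorff_measure_empty:
  assumes "1 \<le> k"
  shows "hausdorff_measure k ({} :: 'a::metric_space set) = 0"
proof -
  have "hausdorff_pre k d ({} :: 'a set) \<le> 0" if "0 < d" for d
    unfolding hausdorff_pre_def
    by (rule INF_lower2[of "\<lambda>_. {}"]) (use that assms in \<open>auto simp: power_0_left\<close>)
  then have "hausdorff_measure k ({} :: 'a set) \<le> 0"
    unfolding hausdorff_measure_eq_SUP by (intro SUP_least) auto
  then show ?thesis by simp
qed

lemma hausdorff_measure_finite_cover_le:
  assumes "1 \<le> k" "finite I" "S \<subseteq> (\<Union>i\<in>I. U i)" "0 \<le> m"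
    and "\<And>i. i \<in> I \<Longrightarrow> hausdorff_measure k (U i) \<le> ennreal m"
  shows "hausdorff_measure k S \<le> ennreal (real (card I) * m)"
  using assms(2,3,5)
proof (induction I arbitrary: S)
  case empty
  then show ?case by (simp add: hausdorff_measure_empty[OF assms(1)])
next
  case (insert i I)
  have "hausdorff_measure k S \<le> hausdorff_measure k (U i \<union> (\<Union>i\<in>I. U i))"
    using insert.prems by (intro hausdorff_measure_mono) auto
  also have "\<dots> \<le> hausdorff_measure k (U i) + hausdorff_measure k (\<Union>i\<in>I. U i)"
    by (rule hausdorff_measure_Un)
  also have "\<dots> \<le> ennreal m + ennreal (real (card I) * m)"
    using insert.prems insert.IH[of "\<Union>i\<in>I. U i"] by (intro add_mono) auto
  also have "\<dots> = ennreal (real (card (insert i I)) * m)"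
    using insert.hyps assms(4) by (simp add: ennreal_plus[symmetric] algebra_simps del: ennreal_plus)
  finally show ?case .
qed

text \<open>Disjoint balls of radius \<open>\<tau> / 2\<close> around the points fit into the enlarged box.\<close>
lemma card_separated_in_box:
  fixes Y :: "(real ^ 'n) set"
  assumes "finite Y" "0 < \<tau>" "\<And>i. 0 \<le> R i"
    and sep: "\<And>y z. y \<in> Y \<Longrightarrow> z \<in> Y \<Longrightarrow> y \<noteq> z \<Longrightarrow> \<tau> \<le> dist y z"
    and box: "\<And>y i. y \<in> Y \<Longrightarrow> \<bar>y $ i\<bar> \<le> R i"
  shows "real (card Y) * ((\<tau> / 2) ^ CARD('n) * measure lebesgue (cball (0 :: real ^ 'n) 1))
    \<le> (\<Prod>i\<in>UNIV. 2 * R i + \<tau>)"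
proof -
  define l where "l = (\<chi> i. - (R i + \<tau> / 2) :: real ^ 'n)"
  define u where "u = (\<chi> i. R i + \<tau> / 2 :: real ^ 'n)"
  have vol: "measure lebesgue (ball y (\<tau> / 2)) = (\<tau> / 2) ^ CARD('n) * measure lebesgue (cball (0 :: real ^ 'n) 1)" for y :: "real ^ 'n"
    using content_ball_conv_unit_ball[of "\<tau> / 2" y] \<open>0 < \<tau>\<close> by (simp add: content_cball_conv_ball)
  have "real (card Y) * ((\<tau> / 2) ^ CARD('n) * measure lebesgue (cball (0 :: real ^ 'n) 1))
      = (\<Sum>y\<in>Y. measure lebesgue (ball y (\<tau> / 2)))"
    unfolding vol by simp
  also have "\<dots> = measure lebesgue (\<Union>y\<in>Y. ball y (\<tau> / 2))"
  proof (rule measure_finite_Union[symmetric, OF \<open>finite Y\<close>])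
    show "disjoint_family_on (\<lambda>y. ball y (\<tau> / 2)) Y"
      unfolding disjoint_family_on_def using sep by (auto intro!: disjoint_ballI)
    show "emeasure lebesgue (ball y (\<tau> / 2)) \<noteq> \<infinity>" for y
      using fmeasurableD2[OF lmeasurable_ball] by auto
  qed auto
  also have "\<dots> \<le> measure lebesgue (cbox l u)"
  proof (rule measure_mono_fmeasurable)
    show "(\<Union>y\<in>Y. ball y (\<tau> / 2)) \<subseteq> cbox l u"
    proof
      fix z assume "z \<in> (\<Union>y\<in>Y. ball y (\<tau> / 2))"
      then obtain y where y: "y \<in> Y" "norm (z - y) < \<tau> / 2"
        by (auto simp: dist_norm norm_minus_commute)
      have "- (R i + \<tau> / 2) \<le> z $ i \<and> z $ i \<le> R i + \<tau> / 2" for i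
        using component_le_norm_cart[of "z - y" i] box[OF y(1), of i] y(2)
        unfolding vector_minus_component by linarith
      then show "z \<in> cbox l u"
        by (simp add: mem_box_cart l_def u_def)
    qed
    show "(\<Union>y\<in>Y. ball y (\<tau> / 2)) \<in> sets lebesgue"
      using \<open>finite Y\<close> by (intro sets.finite_UN) auto
  qed auto
  also have "\<dots> = (\<Prod>i\<in>UNIV. 2 * R i + \<tau>)"
  proof -
    have "l $ i \<le> u $ i" for i
      using assms(2) assms(3)[of i] unfolding l_def u_def by simp
    then have "cbox l u \<noteq> {}" by (simp add: interval_ne_empty_cart)
    then show ?thesis by (simp add: content_cbox_cart l_def u_def algebra_simps)
  qed
  finally show ?thesis .
qed

section \<open>Orthogonal projections\<close>

lemma inner_orthogonal_comp:
  assumes "v \<in> V" "w \<in> orthogonal_comp V"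
  shows "v \<bullet> w = 0" "w \<bullet> v = 0"
  using assms by (auto simp: orthogonal_comp_def orthogonal_def inner_commute)

lemma orth_proj_eqI:
  assumes "subspace V" "p \<in> V" "x - p \<in> orthogonal_comp V"
  shows "orth_proj V x = p"
  using orth_proj_ex1[OF assms(1), of x] orth_proj[OF assms(1), of x] assms(2,3) by blast

lemma orth_proj_eq_self: "subspace V \<Longrightarrow> v \<in> V \<Longrightarrow> orth_proj V v = v"
  by (rule orth_proj_eqI) (simp_all add: subspace_0 subspace_orthogonal_comp)

lemma linear_orth_proj:
  assumes "subspace V"
  shows "linear (orth_proj V)"
proof (rule linearI)
  note P = orth_proj[OF assms] and C = subspace_orthogonal_comp[of V]
  fix x y :: 'a and c :: real
  have "(x - orth_proj V x) + (y - orth_proj V y) \<in> orthogonal_comp V"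
    by (intro subspace_add[OF C] P)
  then show "orth_proj V (x + y) = orth_proj V x + orth_proj V y"
    by (intro orth_proj_eqI assms subspace_add P) (simp add: algebra_simps)
  have "c *\<^sub>R (x - orth_proj V x) \<in> orthogonal_comp V"
    by (intro subspace_scale[OF C] P)
  then show "orth_proj V (c *\<^sub>R x) = c *\<^sub>R orth_proj V x"
    by (intro orth_proj_eqI assms subspace_scale P) (simp add: scaleR_diff_right)
qed

lemma orth_proj_orthogonal_comp:
  assumes "subspace V"
  shows "orth_proj (orthogonal_comp V) x = x - orth_proj V x"
  using orth_proj[OF assms, of x] assms
  by (intro orth_proj_eqI subspace_orthogonal_comp) (simp_all add: orthogonal_comp_self)

lemma inner_orth_proj:
  assumes "subspace V" "v \<in> V"
  shows "orth_proj V x \<bullet> v = x \<bullet> v"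
  using inner_orthogonal_comp(2)[OF assms(2) orth_proj(2)[OF assms(1), of x]]
  by (simp add: inner_diff_left)

lemma norm_diff_orth_proj_le:
  assumes "subspace V" "p \<in> V"
  shows "norm (x - orth_proj V x) \<le> norm (x - p)"
proof -
  have "orthogonal (x - orth_proj V x) (orth_proj V x - p)"
    using inner_orthogonal_comp(2)[OF subspace_diff[OF assms(1) orth_proj(1)[OF assms(1)] assms(2)]
        orth_proj(2)[OF assms(1)]]
    by (simp add: orthogonal_def)
  from norm_add_Pythagorean[OF this] have "(norm (x - orth_proj V x))\<^sup>2 \<le> (norm (x - p))\<^sup>2"
    by simp
  then show ?thesis by (rule power2_le_imp_le) simp
qed

lemma norm_orth_proj_le:
  assumes "subspace V"
  shows "norm (orth_proj V x) \<le> norm x"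
proof -
  have "orthogonal (x - orth_proj V x) (orth_proj V x)"
    using inner_orthogonal_comp(2)[OF orth_proj(1)[OF assms] orth_proj(2)[OF assms]]
    by (simp add: orthogonal_def)
  from norm_add_Pythagorean[OF this] have "(norm (orth_proj V x))\<^sup>2 \<le> (norm x)\<^sup>2" by simp
  then show ?thesis by (rule power2_le_imp_le) simp
qed

text \<open>Projections do not increase norms, so inside the ball the paraboloid is trapped in a
  slab about \<open>x + V\<close>. The later estimates use the paraboloids through this
  slab.\<close>

lemma paraboloid_cball:
  assumes "subspace V" "z \<in> paraboloid \<alpha> x V lam" "dist x z \<le> r" "0 \<le> lam" "0 \<le> \<alpha>"
  shows "norm ((z - x) - orth_proj V (z - x)) \<le> lam * r powr (1 + \<alpha>)"
proof -
  have "norm (orth_proj V (z - x)) \<le> r"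
    using norm_orth_proj_le[OF assms(1), of "z - x"] assms(3) by (simp add: dist_norm norm_minus_commute)
  then have "lam * norm (orth_proj V (z - x)) powr (1 + \<alpha>) \<le> lam * r powr (1 + \<alpha>)"
    using assms(4,5) by (intro mult_left_mono powr_mono2) auto
  then show ?thesis
    using assms(2) unfolding paraboloid_def orth_proj_orthogonal_comp[OF assms(1)] by simp
qed

section \<open>Sets near two planes\<close>

text \<open>The bound \<open>N\<close> yields a separated set of largest cardinality; a point
  outside all its balls could be added to it.\<close>

lemma maximal_separated_net:
  fixes S :: "'a::metric_space set"
  assumes "0 < \<tau>"
    and bound: "\<And>Z. Z \<subseteq> S \<Longrightarrow> finite Z \<Longrightarrow> pairwise (\<lambda>y z. \<tau> \<le> dist y z) Z \<Longrightarrow> card Z \<le> N"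
  obtains Z where "Z \<subseteq> S" "finite Z" "pairwise (\<lambda>y z. \<tau> \<le> dist y z) Z" "S \<subseteq> (\<Union>z\<in>Z. cball z \<tau>)"
proof -
  define P where "P Z \<longleftrightarrow> Z \<subseteq> S \<and> finite Z \<and> pairwise (\<lambda>y z. \<tau> \<le> dist y z) Z" for Z
  have "P {}" by (simp add: P_def)
  moreover have "\<forall>Y. P Y \<longrightarrow> card Y < Suc N"
    using bound by (auto simp: P_def less_Suc_eq_le)
  ultimately obtain Z where Z: "P Z" and max: "\<And>Y. P Y \<Longrightarrow> card Y \<le> card Z"
    using ex_has_greatest_nat[of P "{}" card "Suc N"] by blast
  have "S \<subseteq> (\<Union>z\<in>Z. cball z \<tau>)"
  proof
    fix s assume s: "s \<in> S"
    show "s \<in> (\<Union>z\<in>Z. cball z \<tau>)"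
    proof (rule ccontr)
      assume far: "s \<notin> (\<Union>z\<in>Z. cball z \<tau>)"
      then have "s \<notin> Z" using \<open>0 < \<tau>\<close> by force
      moreover have "P (insert s Z)"
        using Z s far by (auto simp: P_def pairwise_insert dist_commute not_le intro: less_imp_le)
      ultimately show False using max[of "insert s Z"] Z by (auto simp: P_def)
    qed
  qed
  then show ?thesis using that Z by (auto simp: P_def)
qed

text \<open>Coordinates in an orthonormal basis adapted to \<open>W\<close> and its orthogonal
  complement map the points isometrically into a box with \<open>dim W\<close> sides governed by
  \<open>R\<close> and the others by \<open>a\<close>, where balls can be packed.\<close>

lemma card_separated_near_subspace:
  fixes Z :: "(real ^ 'n) set"
  assumes W: "subspace W" and "finite Z" "0 < \<tau>" "0 \<le> R" "0 \<le> a"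
    and sep: "pairwise (\<lambda>y z. \<tau> \<le> dist y z) Z"
    and tangential: "\<And>z. z \<in> Z \<Longrightarrow> norm (orth_proj W (z - c)) \<le> R"
    and normal: "\<And>z. z \<in> Z \<Longrightarrow> norm ((z - c) - orth_proj W (z - c)) \<le> a"
  shows "real (card Z) * ((\<tau> / 2) ^ CARD('n) * measure lebesgue (cball (0 :: real ^ 'n) 1))
    \<le> (2 * R + \<tau>) ^ dim W * (2 * a + \<tau>) ^ (CARD('n) - dim W)"
proof -
  obtain B1 where B1: "B1 \<subseteq> W" "pairwise orthogonal B1" "\<And>b. b \<in> B1 \<Longrightarrow> norm b = 1"
      "independent B1" "card B1 = dim W" "span B1 = W"
    using orthonormal_basis_subspace[OF W] by blast
  obtain B2 where B2: "B2 \<subseteq> orthogonal_comp W" "pairwise orthogonal B2" "\<And>b. b \<in> B2 \<Longrightarrow> norm b = 1"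
      "independent B2" "card B2 = dim (orthogonal_comp W)" "span B2 = orthogonal_comp W"
    using orthonormal_basis_subspace[OF subspace_orthogonal_comp] by metis
  define B where "B = B1 \<union> B2"
  have fin: "finite B1" "finite B2" using B1(4) B2(4) by (simp_all add: independent_imp_finite)
  have orth12: "x \<bullet> y = 0" "y \<bullet> x = 0" if "x \<in> B1" "y \<in> B2" for x y
    using inner_orthogonal_comp[of x W y] B1(1) B2(1) that by auto
  have disj: "B1 \<inter> B2 = {}"
    using orth12 B1(3) by (force simp: norm_eq_1)
  have orth: "pairwise orthogonal B"
    using B1(2) B2(2) orth12 unfolding B_def pairwise_def orthogonal_def by blast
  have norm1: "norm b = 1" if "b \<in> B" for b using that B1(3) B2(3) by (auto simp: B_def)
  have spanB: "x \<in> span B" for x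
  proof -
    have "orth_proj W x \<in> span B" "x - orth_proj W x \<in> span B"
      using orth_proj[OF W, of x] span_mono[of B1 B] span_mono[of B2 B]
      by (auto simp: B1(6) B2(6) B_def)
    from span_add[OF this] show ?thesis by simp
  qed
  have "0 \<notin> B" using norm1 by fastforce
  then have "independent B" using orth pairwise_orthogonal_independent by blast
  moreover have "span B = UNIV" using spanB by blast
  ultimately have "card B = CARD('n)" using dim_eq_card[of B UNIV] by simp
  have cardB2: "card B2 = CARD('n) - dim W"
    using \<open>card B = CARD('n)\<close> card_Un_disjoint[OF fin disj] B1(5) by (simp add: B_def)
  have finB: "finite B" using fin by (simp add: B_def)
  \<comment> \<open>Indexing the adapted basis by \<open>'n\<close> makes the coordinate vector
    again an element of \<open>real ^ 'n\<close>, as the box estimate requires.\<close>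
  obtain b :: "'n \<Rightarrow> real ^ 'n" where b: "bij_betw b UNIV B"
    using finite_same_card_bij[of "UNIV :: 'n set" B] finB \<open>card B = CARD('n)\<close> by auto
  define h where "h z = (\<chi> i. b i \<bullet> (z - c))" for z :: "real ^ 'n"
  have isom: "norm (\<chi> i. b i \<bullet> v) = norm v" for v
  proof -
    have "(norm (\<chi> i. b i \<bullet> v))\<^sup>2 = (\<Sum>i\<in>UNIV. (b i \<bullet> v) * (b i \<bullet> v))"
      by (simp add: power2_norm_eq_inner inner_vec_def)
    also have "\<dots> = (\<Sum>x\<in>B. (x \<bullet> v) * (x \<bullet> v))"
      using b by (rule sum.reindex_bij_betw)
    also have "\<dots> = (\<Sum>x\<in>B. (v \<bullet> x) *\<^sub>R x) \<bullet> v"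
      by (simp add: inner_sum_left inner_commute[of v])
    also have "\<dots> = (norm v)\<^sup>2"
      by (simp add: orthonormal_basis_expand[OF orth norm1 spanB finB] power2_norm_eq_inner)
    finally show ?thesis by simp
  qed
  have h_dist: "dist (h y) (h z) = dist y z" for y z
  proof -
    have "h y - h z = (\<chi> i. b i \<bullet> (y - z))"
      by (simp add: h_def vec_eq_iff inner_diff_right)
    then show ?thesis by (simp add: dist_norm isom)
  qed
  have inj: "inj_on h Z" by (rule inj_onI) (metis h_dist dist_eq_0_iff)
  define g where "g x = 2 * (if x \<in> B1 then R else a) + \<tau>" for x
  have "real (card (h ` Z)) * ((\<tau> / 2) ^ CARD('n) * measure lebesgue (cball (0 :: real ^ 'n) 1))
      \<le> (\<Prod>i\<in>UNIV. 2 * (if b i \<in> B1 then R else a) + \<tau>)"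
  proof (rule card_separated_in_box)
    show "\<tau> \<le> dist y z" if "y \<in> h ` Z" "z \<in> h ` Z" "y \<noteq> z" for y z
      using that sep unfolding pairwise_def by (force simp: h_dist)
    show "\<bar>y $ i\<bar> \<le> (if b i \<in> B1 then R else a)" if yZ: "y \<in> h ` Z" for y i
    proof -
      obtain z where z: "z \<in> Z" "y = h z" using yZ by blast
      define v where "v = z - c"
      have y: "y $ i = b i \<bullet> v" by (simp add: z h_def v_def)
      have bi: "b i \<in> B" using b by (auto simp: bij_betw_def)
      have CS: "\<bar>b i \<bullet> w\<bar> \<le> norm w" for w
        using Cauchy_Schwarz_ineq2[of "b i" w] norm1[OF bi] by simp
      show ?thesis
      proof (cases "b i \<in> B1")
        case True
        then have "b i \<bullet> v = b i \<bullet> orth_proj W v"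
          using inner_orth_proj[OF W, of "b i" v] B1(1) by (auto simp: inner_commute)
        then show ?thesis using CS[of "orth_proj W v"] tangential[OF z(1)] True
          by (simp add: y v_def)
      next
        case False
        then have "b i \<in> orthogonal_comp W" using bi B2(1) by (auto simp: B_def)
        then have "b i \<bullet> v = b i \<bullet> (v - orth_proj W v)"
          using inner_orthogonal_comp(2)[OF orth_proj(1)[OF W]] by (simp add: inner_diff_right)
        then show ?thesis using CS[of "v - orth_proj W v"] normal[OF z(1)] False
          by (simp add: y v_def)
      qed
    qed
  qed (use assms in auto)
  also have "(\<Prod>i\<in>UNIV. 2 * (if b i \<in> B1 then R else a) + \<tau>) = (\<Prod>x\<in>B. g x)"
    unfolding g_def using b by (rule prod.reindex_bij_betw)
  also have "\<dots> = (\<Prod>x\<in>B1. g x) * (\<Prod>x\<in>B2. g x)"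
    unfolding B_def using fin disj by (rule prod.union_disjoint)
  also have "(\<Prod>x\<in>B1. g x) = (2 * R + \<tau>) ^ dim W"
    by (simp add: g_def B1(5))
  also have "(\<Prod>x\<in>B2. g x) = (\<Prod>x\<in>B2. 2 * a + \<tau>)"
    using disj by (intro prod.cong) (auto simp: g_def)
  also have "\<dots> = (2 * a + \<tau>) ^ (CARD('n) - dim W)"
    by (simp add: cardB2)
  finally show ?thesis by (simp add: card_image[OF inj])
qed

text \<open>A maximal \<tau>-separated net has at most a constant times
  \<open>(r / \<tau>) ^ (k - 1)\<close> points, and each ball about them carries at most
  \<open>M * \<tau> ^ k\<close>. One dimension fewer than \<open>k\<close> thus gains a factor
  \<open>\<tau> / r\<close> over \<open>r ^ k\<close>.\<close>

lemma hausdorff_measure_near_subspace: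
  fixes S :: "(real ^ 'n) set"
  assumes k: "1 \<le> k" and W: "subspace W" "dim W < k" and \<tau>: "0 < \<tau>" "\<tau> \<le> r" and M: "0 \<le> M"
    and tangential: "\<And>z. z \<in> S \<Longrightarrow> norm (orth_proj W (z - c)) \<le> r"
    and normal: "\<And>z. z \<in> S \<Longrightarrow> norm ((z - c) - orth_proj W (z - c)) \<le> 2 * \<tau>"
    and upper: "\<And>z. z \<in> S \<Longrightarrow> hausdorff_measure k (S \<inter> cball z \<tau>) \<le> ennreal (M * \<tau> ^ k)"
  shows "hausdorff_measure k S
    \<le> ennreal (10 ^ CARD('n) * M * \<tau> * r ^ (k - 1) / measure lebesgue (cball (0 :: real ^ 'n) 1))"
proof -
  define \<omega> where "\<omega> = measure lebesgue (cball (0 :: real ^ 'n) 1)"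
  have \<omega>: "0 < \<omega>" unfolding \<omega>_def using content_cball_pos[of 1 "0 :: real ^ 'n"] by simp
  define m where "m = dim W"
  have m: "m \<le> CARD('n)" "m \<le> k - 1"
    using dim_subset_UNIV[of W] W(2) by (simp_all add: m_def)
  have r: "0 < r" using \<tau> by linarith
  have count: "real (card Z) \<le> 10 ^ CARD('n) * (r / \<tau>) ^ (k - 1) / \<omega>"
    if Z: "Z \<subseteq> S" "finite Z" "pairwise (\<lambda>y z. \<tau> \<le> dist y z) Z" for Z
  proof -
    have "real (card Z) * ((\<tau> / 2) ^ CARD('n) * \<omega>) \<le> (2 * r + \<tau>) ^ m * (2 * (2 * \<tau>) + \<tau>) ^ (CARD('n) - m)"
      unfolding \<omega>_def m_def
      by (rule card_separated_near_subspace[where c = c]) (use W Z \<tau> r tangential normal in auto)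
    \<comment> \<open>The long sides are enlarged so that both kinds share the factor 5; since
      \<open>5 * \<tau> = 10 * (\<tau> / 2)\<close>, this is the source of
      \<open>10 ^ CARD('n)\<close>.\<close>
    also have "\<dots> \<le> (5 * r) ^ m * (5 * \<tau>) ^ (CARD('n) - m)"
      using \<tau> r by (intro mult_mono power_mono) auto
    also have "\<dots> = (5 * \<tau>) ^ CARD('n) * (r / \<tau>) ^ m"
    proof -
      have "5 * r = 5 * \<tau> * (r / \<tau>)" using \<tau> by simp
      then have "(5 * r) ^ m = (5 * \<tau>) ^ m * (r / \<tau>) ^ m"
        by (simp only: power_mult_distrib)
      moreover have "(5 * \<tau>) ^ m * (5 * \<tau>) ^ (CARD('n) - m) = (5 * \<tau>) ^ CARD('n)"
        unfolding power_add[symmetric] using m(1) by simp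
      ultimately show ?thesis by (simp add: ac_simps)
    qed
    also have "\<dots> \<le> (5 * \<tau>) ^ CARD('n) * (r / \<tau>) ^ (k - 1)"
      using \<tau> r m by (intro mult_left_mono power_increasing) auto
    also have "(5 * \<tau>) ^ CARD('n) = 10 ^ CARD('n) * (\<tau> / 2) ^ CARD('n)"
      unfolding power_mult_distrib[symmetric] by simp
    finally have "(\<tau> / 2) ^ CARD('n) * (real (card Z) * \<omega>)
        \<le> (\<tau> / 2) ^ CARD('n) * (10 ^ CARD('n) * (r / \<tau>) ^ (k - 1))"
      by (simp only: ac_simps)
    then have "real (card Z) * \<omega> \<le> 10 ^ CARD('n) * (r / \<tau>) ^ (k - 1)"
      by (rule mult_left_le_imp_le) (use \<tau> in simp)
    then show ?thesis using \<omega> by (simp add: pos_le_divide_eq)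
  qed
  obtain N :: nat where N: "10 ^ CARD('n) * (r / \<tau>) ^ (k - 1) / \<omega> \<le> real N"
    using real_arch_simple by blast
  have bound: "card Z \<le> N" if "Z \<subseteq> S" "finite Z" "pairwise (\<lambda>y z. \<tau> \<le> dist y z) Z" for Z
    using order_trans[OF count[OF that] N] by simp
  obtain Z
    where Z: "Z \<subseteq> S" "finite Z" "pairwise (\<lambda>y z. \<tau> \<le> dist y z) Z" "S \<subseteq> (\<Union>z\<in>Z. cball z \<tau>)"
    by (rule maximal_separated_net[OF \<tau>(1) bound])
  have "hausdorff_measure k S \<le> ennreal (real (card Z) * (M * \<tau> ^ k))"
    by (rule hausdorff_measure_finite_cover_le[OF k Z(2), where U = "\<lambda>z. S \<inter> cball z \<tau>"])
      (use Z upper M \<tau> in auto)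
  also have "\<dots> \<le> ennreal (10 ^ CARD('n) * (r / \<tau>) ^ (k - 1) / \<omega> * (M * \<tau> ^ k))"
    using count[OF Z(1-3)] M \<tau> by (intro ennreal_leI mult_right_mono) auto
  also have "10 ^ CARD('n) * (r / \<tau>) ^ (k - 1) / \<omega> * (M * \<tau> ^ k) = 10 ^ CARD('n) * M * \<tau> * r ^ (k - 1) / \<omega>"
    using \<tau> k by (cases k) (auto simp: power_divide field_simps)
  finally show ?thesis unfolding \<omega>_def .
qed

text \<open>Both conclusions come from the set \<open>G\<close> of points of \<open>E\<close> near
  \<open>x\<close> lying in both paraboloids, whose measure is at least
  \<open>\<delta> * r ^ k / 2\<close>. A unit vector of \<open>V\<close> at distance
  \<open>s\<close> from \<open>V'\<close> confines \<open>G\<close> to a neighbourhood of a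
  \<open>(k - 1)\<close>-plane of width of order \<open>lam * r powr (1 + \<alpha>) / s\<close>, so
  \<open>s\<close> cannot be large.\<close>

lemma planes_close:
  fixes E :: "(real ^ 'n) set" and x y :: "real ^ 'n"
  defines "\<omega> \<equiv> measure lebesgue (cball (0 :: real ^ 'n) 1)"
  assumes k: "1 \<le> k" and \<alpha>: "0 < \<alpha>" "\<alpha> \<le> 1" and lam: "0 < lam" and \<delta>: "0 < \<delta>" and M: "0 < M"
    and V: "linear_plane k V" and V': "linear_plane k V'"
    and r: "0 < r" "dist x y = r" and \<epsilon>: "\<epsilon> * (1 + 2 ^ k) \<le> 1 / 2" "0 \<le> \<epsilon>"
    and lower: "ennreal (\<delta> * r ^ k) \<le> hausdorff_measure k (E \<inter> cball x r)"
    and upper: "\<And>z s. z \<in> E \<Longrightarrow> 0 < s \<Longrightarrow> hausdorff_measure k (E \<inter> cball z s) \<le> ennreal (M * s ^ k)"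
    and bad: "hausdorff_measure k ((E \<inter> cball x r) - paraboloid \<alpha> x V lam) \<le> ennreal (\<epsilon> * \<delta> * r ^ k)"
    and bad': "hausdorff_measure k ((E \<inter> cball y (2 * r)) - paraboloid \<alpha> y V' lam) \<le> ennreal (\<epsilon> * \<delta> * (2 * r) ^ k)"
  shows "\<exists>z. dist x z \<le> r \<and> z \<in> paraboloid \<alpha> x V lam \<and> z \<in> paraboloid \<alpha> y V' lam" (is ?good)
    and "\<forall>u\<in>V. norm (u - orth_proj V' u)
      \<le> max (5 * lam) (10 ^ (CARD('n) + 1) * M * lam / (\<delta> * \<omega>)) * r powr \<alpha> * norm u" (is ?close)
proof -
  define G where "G = E \<inter> cball x r \<inter> paraboloid \<alpha> x V lam \<inter> paraboloid \<alpha> y V' lam"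
  have sV: "subspace V" "dim V = k" and sV': "subspace V'"
    using V V' by (auto simp: linear_plane_def)
  \<comment> \<open>A point of \<open>E\<close> in the ball about \<open>x\<close> but not in
    \<open>G\<close> misses one of the paraboloids. The second one is controlled on the ball of
    radius \<open>2 * r\<close> about \<open>y\<close>, which contains the ball about
    \<open>x\<close>; hence the factor \<open>1 + 2 ^ k\<close>.\<close>
  have G_large: "\<not> hausdorff_measure k G < ennreal (\<delta> * r ^ k / 2)"
  proof
    assume less: "hausdorff_measure k G < ennreal (\<delta> * r ^ k / 2)"
    define b where "b = (E \<inter> cball x r) - paraboloid \<alpha> x V lam"
    define b' where "b' = (E \<inter> cball y (2 * r)) - paraboloid \<alpha> y V' lam"
    have "z \<in> cball y (2 * r)" if "z \<in> cball x r" for z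
      using that r dist_triangle[of y z x] by (simp add: dist_commute)
    then have "E \<inter> cball x r \<subseteq> G \<union> (b \<union> b')"
      by (auto simp: G_def b_def b'_def)
    then have "ennreal (\<delta> * r ^ k) \<le> hausdorff_measure k (G \<union> (b \<union> b'))"
      using lower hausdorff_measure_mono order_trans by blast
    also have "\<dots> \<le> hausdorff_measure k G + (hausdorff_measure k b + hausdorff_measure k b')"
      by (intro order_trans[OF hausdorff_measure_Un] add_left_mono hausdorff_measure_Un)
    also have "\<dots> \<le> hausdorff_measure k G + (ennreal (\<epsilon> * \<delta> * r ^ k) + ennreal (\<epsilon> * \<delta> * (2 * r) ^ k))"
      using bad bad' unfolding b_def b'_def by (intro add_left_mono add_mono)
    also have "\<dots> = hausdorff_measure k G + ennreal ((\<epsilon> * (1 + 2 ^ k)) * (\<delta> * r ^ k))"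
      using \<epsilon> \<delta> r by (simp add: ennreal_plus[symmetric] power_mult_distrib algebra_simps del: ennreal_plus)
    also have "\<dots> \<le> hausdorff_measure k G + ennreal (1 / 2 * (\<delta> * r ^ k))"
      using \<epsilon> \<delta> r by (intro add_left_mono ennreal_leI mult_right_mono) auto
    also have "\<dots> < ennreal (\<delta> * r ^ k / 2) + ennreal (1 / 2 * (\<delta> * r ^ k))"
      using less by (simp add: ennreal_add_left_cancel_less add.commute)
    also have "\<dots> = ennreal (\<delta> * r ^ k)"
      using \<delta> r by (simp add: ennreal_plus[symmetric] del: ennreal_plus)
    finally show False by simp
  qed
  have "0 < \<delta> * r ^ k / 2" using \<delta> r by simp
  then have "G \<noteq> {}"
    using G_large hausdorff_measure_empty[OF k, where 'a = "real ^ 'n"] by force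
  then show ?good by (auto simp: G_def)
  have \<omega>: "0 < \<omega>" unfolding \<omega>_def using content_cball_pos[of 1 "0 :: real ^ 'n"] by simp
  define K where "K = max (5 * lam) (10 ^ (CARD('n) + 1) * M * lam / (\<delta> * \<omega>))"
  have unit: "norm (u - orth_proj V' u) \<le> K * r powr \<alpha>" if u: "u \<in> V" "norm u = 1" for u
  proof (cases "u = orth_proj V' u")
    case True
    then show ?thesis using lam by (simp add: K_def le_max_iff_disj)
  next
    case False
    define s where "s = norm (u - orth_proj V' u)"
    have s: "0 < s" "s \<le> 1"
      using False norm_diff_orth_proj_le[OF sV' subspace_0[OF sV'], of u] u by (auto simp: s_def)
    \<comment> \<open>A unit normal of \<open>V'\<close> that detects the tilt: its inner product
      with \<open>u\<close> is exactly \<open>s\<close>.\<close>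
    define w where "w = (1 / s) *\<^sub>R (u - orth_proj V' u)"
    have w1: "norm w = 1" using s by (simp add: w_def s_def)
    have wV': "w \<in> orthogonal_comp V'"
      unfolding w_def by (intro subspace_scale[OF subspace_orthogonal_comp] orth_proj sV')
    have "(u - orth_proj V' u) \<bullet> u = s * s"
    proof -
      have "(u - orth_proj V' u) \<bullet> orth_proj V' u = 0"
        using inner_orthogonal_comp(2) orth_proj[OF sV'] by blast
      then have "(u - orth_proj V' u) \<bullet> u = (u - orth_proj V' u) \<bullet> (u - orth_proj V' u)"
        by (simp add: inner_diff_right)
      then show ?thesis by (simp add: s_def power2_norm_eq_inner[symmetric] power2_eq_square)
    qed
    then have wu: "w \<bullet> u = s" using s by (simp add: w_def)
    \<comment> \<open>On \<open>V\<close> the functional given by \<open>w\<close> is represented by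
      \<open>e0\<close>; its norm is at least \<open>s\<close> because it takes the value
      \<open>s\<close> at the unit vector \<open>u\<close>.\<close>
    define e0 where "e0 = orth_proj V w"
    have e0V: "e0 \<in> V" unfolding e0_def by (rule orth_proj[OF sV(1)])
    have "e0 \<bullet> u = s" unfolding e0_def using inner_orth_proj[OF sV(1) u(1), of w] wu by simp
    then have e0: "s \<le> norm e0" using norm_cauchy_schwarz[of e0 u] u by simp
    then have e0pos: "0 < norm e0" using s by linarith
    define e where "e = (1 / norm e0) *\<^sub>R e0"
    have e1: "norm e = 1" using e0pos by (simp add: e_def)
    have ee: "e \<bullet> e = 1" using e1 by (simp add: norm_eq_1)
    have eV: "e \<in> V" unfolding e_def by (intro subspace_scale sV e0V)
    define W where "W = {v \<in> V. e \<bullet> v = 0}"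
    have sW: "subspace W"
      using sV(1) by (auto simp: W_def subspace_def inner_add_right)
    have "e \<notin> W" by (simp add: W_def ee)
    then have "dim W < k"
      unfolding sV(2)[symmetric] using eV
      by (intro dim_psubset) (auto simp: span_eq_iff[THEN iffD2, OF sW] span_eq_iff[THEN iffD2, OF sV(1)], auto simp: W_def)
    define t where "t = lam * r powr (1 + \<alpha>)"
    have t: "0 < t" using lam r by (simp add: t_def)
    \<comment> \<open>The slab at \<open>x\<close> contributes \<open>t\<close> and the slab at
      \<open>y\<close>, taken at the doubled radius, contributes \<open>4 * t\<close>. Division by
      \<open>s\<close> turns the bound along \<open>w\<close> into one along
      \<open>e\<close>.\<close>
    define \<tau> where "\<tau> = 5 * t / s"
    have \<tau>: "0 < \<tau>" "t \<le> \<tau>" using t s by (auto simp: \<tau>_def field_simps intro: order_trans[of _ "5 * t"])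
    have t_eq: "t = lam * r powr \<alpha> * r" using r by (simp add: t_def powr_add)
    show ?thesis
    proof (cases "\<tau> \<le> r")
      \<comment> \<open>Without \<tau> \<le> \<open>r\<close> the packing estimate does not apply,
        but then \<open>s\<close> is already small; this case accounts for the entry
        \<open>5 * lam\<close> of the maximum.\<close>
      case False
      then have "s < 5 * lam * r powr \<alpha>"
        using s r t_eq by (simp add: \<tau>_def field_simps)
      also have "\<dots> \<le> K * r powr \<alpha>" by (intro mult_right_mono) (auto simp: K_def)
      finally show ?thesis by (simp add: s_def)
    next
      case True
      \<comment> \<open>The point \<open>c\<close> is where the line through \<open>x\<close> in
        direction \<open>e\<close> meets the hyperplane through \<open>y\<close> orthogonal to
        \<open>w\<close>; it centres the strip around a translate of \<open>W\<close>.\<close>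
      define c0 where "c0 = w \<bullet> (y - x) / norm e0"
      define c where "c = x + c0 *\<^sub>R e"
      have slab: "norm (orth_proj W (z - c)) \<le> r \<and> norm ((z - c) - orth_proj W (z - c)) \<le> 2 * \<tau>"
        if z: "z \<in> G" for z
      proof -
        define v where "v = z - x"
        define p where "p = orth_proj V v"
        have nv: "norm v \<le> r" using z by (simp add: G_def v_def dist_norm norm_minus_commute)
        have vp: "norm (v - p) \<le> t"
          unfolding p_def v_def t_def
          by (rule paraboloid_cball) (use z sV \<alpha> lam in \<open>auto simp: G_def\<close>)
        have "dist y z \<le> 2 * r" using z r dist_triangle[of y z x] by (simp add: G_def dist_commute)
        then have "norm ((z - y) - orth_proj V' (z - y)) \<le> lam * (2 * r) powr (1 + \<alpha>)"
          by (rule paraboloid_cball[rotated 2]) (use z sV' \<alpha> lam in \<open>auto simp: G_def\<close>)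
        also have "\<dots> \<le> lam * (4 * r powr (1 + \<alpha>))"
        proof -
          have "(2::real) powr (1 + \<alpha>) \<le> 2 powr 2" using \<alpha> by (intro powr_mono) auto
          then show ?thesis using lam r by (simp add: powr_mult)
        qed
        finally have zy: "norm ((z - y) - orth_proj V' (z - y)) \<le> 4 * t" by (simp add: t_def)
        have "w \<bullet> (z - y) = w \<bullet> ((z - y) - orth_proj V' (z - y))"
          using inner_orthogonal_comp(2)[OF orth_proj(1)[OF sV'] wV'] by (simp add: inner_diff_right)
        then have a1: "\<bar>w \<bullet> (z - y)\<bar> \<le> 4 * t"
          using Cauchy_Schwarz_ineq2[of w "(z - y) - orth_proj V' (z - y)"] w1 zy by simp
        have a2: "\<bar>w \<bullet> (v - p)\<bar> \<le> t"
          using Cauchy_Schwarz_ineq2[of w "v - p"] w1 vp by simp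
        have "e0 \<bullet> p = w \<bullet> p"
          unfolding e0_def p_def by (rule inner_orth_proj[OF sV(1) orth_proj(1)[OF sV(1)]])
        then have "e0 \<bullet> p - w \<bullet> (y - x) = w \<bullet> (z - y) - w \<bullet> (v - p)"
          by (simp add: v_def inner_diff_right)
        then have "\<bar>e0 \<bullet> p - w \<bullet> (y - x)\<bar> \<le> 5 * t" using a1 a2 by linarith
        moreover have "e \<bullet> p - c0 = (e0 \<bullet> p - w \<bullet> (y - x)) / norm e0"
          by (simp add: e_def c0_def diff_divide_distrib)
        ultimately have "\<bar>e \<bullet> p - c0\<bar> \<le> 5 * t / norm e0"
          using e0pos by (simp add: divide_right_mono)
        also have "\<dots> \<le> \<tau>" unfolding \<tau>_def using e0 e0pos s t by (intro divide_left_mono mult_pos_pos) auto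
        finally have ep: "\<bar>e \<bullet> p - c0\<bar> \<le> \<tau>" .
        have zc: "z - c = v - c0 *\<^sub>R e" by (simp add: v_def c_def)
        have "orth_proj W e = 0"
          by (rule orth_proj_eqI[OF sW subspace_0[OF sW]])
            (auto simp: W_def orthogonal_comp_def orthogonal_def inner_commute)
        then have "orth_proj W (z - c) = orth_proj W v"
          by (simp add: zc linear_diff[OF linear_orth_proj[OF sW]] linear_scale[OF linear_orth_proj[OF sW]])
        then have tan: "norm (orth_proj W (z - c)) \<le> r"
          using norm_orth_proj_le[OF sW, of v] nv by simp
        \<comment> \<open>This vector of \<open>W\<close> competes with the nearest point. Its two
          errors, off \<open>V\<close> and along \<open>e\<close>, are each at most \<tau>, which
          gives the width \<open>2 * \<tau>\<close>.\<close>
        have "p - (e \<bullet> p) *\<^sub>R e \<in> W"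
          unfolding W_def p_def using orth_proj(1)[OF sV(1)] eV sV(1)
          by (auto intro!: subspace_diff subspace_scale simp: inner_diff_right ee)
        then have "norm ((z - c) - orth_proj W (z - c)) \<le> norm ((z - c) - (p - (e \<bullet> p) *\<^sub>R e))"
          by (rule norm_diff_orth_proj_le[OF sW])
        also have "(z - c) - (p - (e \<bullet> p) *\<^sub>R e) = (v - p) + (e \<bullet> p - c0) *\<^sub>R e"
          by (simp add: zc algebra_simps)
        also have "norm \<dots> \<le> norm (v - p) + norm ((e \<bullet> p - c0) *\<^sub>R e)"
          by (rule norm_triangle_ineq)
        also have "\<dots> \<le> \<tau> + \<tau>" using vp \<tau> ep e1 by (intro add_mono) auto
        finally show ?thesis using tan by simp
      qed
      have "hausdorff_measure k G \<le> ennreal (10 ^ CARD('n) * M * \<tau> * r ^ (k - 1) / \<omega>)"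
        unfolding \<omega>_def
      proof (rule hausdorff_measure_near_subspace[OF k sW \<open>dim W < k\<close> \<tau>(1) True])
        show "hausdorff_measure k (G \<inter> cball z \<tau>) \<le> ennreal (M * \<tau> ^ k)" if "z \<in> G" for z
          using that upper[of z \<tau>] \<tau> order_trans[OF hausdorff_measure_mono[of "G \<inter> cball z \<tau>" "E \<inter> cball z \<tau>"]]
          by (auto simp: G_def)
      qed (use slab M in auto)
      with G_large have "ennreal (\<delta> * r ^ k / 2) \<le> ennreal (10 ^ CARD('n) * M * \<tau> * r ^ (k - 1) / \<omega>)"
        by (simp add: not_less)
      then have "\<delta> * r ^ k / 2 \<le> 10 ^ CARD('n) * M * \<tau> * r ^ (k - 1) / \<omega>"
        by (rule ennreal_le_iff[THEN iffD1, rotated]) (use M \<tau> r \<omega> in simp)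
      moreover have "r ^ k = r * r ^ (k - 1)" using k by (cases k) auto
      moreover have "\<tau> = 5 * (lam * r powr \<alpha> * r) / s" by (simp add: \<tau>_def t_eq)
      ultimately have "(r * r ^ (k - 1)) * (\<delta> / 2)
          \<le> (r * r ^ (k - 1)) * (10 ^ CARD('n) * M * (5 * (lam * r powr \<alpha>) / s) / \<omega>)"
        by (simp add: ac_simps)
      then have "\<delta> / 2 \<le> 10 ^ CARD('n) * M * (5 * (lam * r powr \<alpha>) / s) / \<omega>"
        by (rule mult_left_le_imp_le) (use r in simp)
      \<comment> \<open>The additional factor 10 is 5 from the definition of \<tau> times 2 from the
        halved lower density.\<close>
      then have "s \<le> 10 ^ (CARD('n) + 1) * M * lam / (\<delta> * \<omega>) * r powr \<alpha>"
        using s \<omega> \<delta> by (simp add: field_simps)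
      also have "\<dots> \<le> K * r powr \<alpha>" by (intro mult_right_mono) (auto simp: K_def)
      finally show ?thesis by (simp add: s_def)
    qed
  qed
  show ?close
    unfolding K_def[symmetric]
  proof
    fix u assume u: "u \<in> V"
    show "norm (u - orth_proj V' u) \<le> K * r powr \<alpha> * norm u"
    proof (cases "u = 0")
      case True
      then show ?thesis using linear_0[OF linear_orth_proj[OF sV']] by simp
    next
      case False
      define u1 where "u1 = (1 / norm u) *\<^sub>R u"
      have "norm (u1 - orth_proj V' u1) \<le> K * r powr \<alpha>"
        using False u sV(1) by (intro unit) (auto simp: u1_def intro: subspace_scale)
      moreover have "u1 - orth_proj V' u1 = (1 / norm u) *\<^sub>R (u - orth_proj V' u)"
        by (simp add: u1_def linear_scale[OF linear_orth_proj[OF sV']] scaleR_diff_right)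
      ultimately have "norm (u - orth_proj V' u) / norm u \<le> K * r powr \<alpha>" by simp
      then show ?thesis using False by (simp add: pos_divide_le_eq)
    qed
  qed
qed

section \<open>Graphs\<close>

text \<open>Projection to the plane at one fixed point \<open>x0\<close> is injective on
  \<open>E\<close> with Lipschitz inverse \<sigma>. The linear lifts \<open>J x\<close> into the
  planes \<open>V x\<close> serve as derivatives of \<sigma>: flatness gives the Taylor condition of
  a Whitney jet, closeness of the planes the Hoelder condition.\<close>

lemma C1_holder_graph_of_close_planes:
  fixes E :: "'a::euclidean_space set" and V :: "'a \<Rightarrow> 'a set"
  assumes \<alpha>: "0 < \<alpha>" "\<alpha> \<le> 1" and K: "0 \<le> K" and "E \<noteq> {}"
    and V: "\<And>x. x \<in> E \<Longrightarrow> linear_plane k (V x)"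
    and close: "\<And>x y u. x \<in> E \<Longrightarrow> y \<in> E \<Longrightarrow> u \<in> V x \<Longrightarrow>
      norm (u - orth_proj (V y) u) \<le> K * dist x y powr \<alpha> * norm u"
    and flat: "\<And>x y. x \<in> E \<Longrightarrow> y \<in> E \<Longrightarrow>
      norm ((y - x) - orth_proj (V x) (y - x)) \<le> 3 * K * dist x y powr (1 + \<alpha>)"
    and small: "\<And>x y. x \<in> E \<Longrightarrow> y \<in> E \<Longrightarrow> K * dist x y powr \<alpha> \<le> 5 / 24"
  shows "\<exists>G. C1_holder_graph k \<alpha> G \<and> E \<subseteq> G"
proof -
  obtain x0 where x0: "x0 \<in> E" using \<open>E \<noteq> {}\<close> by blast
  have sV: "subspace (V x)" and dV: "dim (V x) = k" if "x \<in> E" for x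
    using V[OF that] by (auto simp: linear_plane_def)
  define P where "P = orth_proj (V x0)"
  have linP: "linear P" unfolding P_def by (rule linear_orth_proj[OF sV[OF x0]])
  have PV: "P h \<in> V x0" for h unfolding P_def by (rule orth_proj[OF sV[OF x0]])
  have normP: "norm (P h) \<le> norm h" for h unfolding P_def by (rule norm_orth_proj_le[OF sV[OF x0]])
  have normQ: "norm (h - P h) \<le> norm h" for h
    unfolding P_def using norm_diff_orth_proj_le[OF sV[OF x0] subspace_0[OF sV[OF x0]], of h] by simp
  have near: "norm (u - P u) \<le> 5 / 24 * norm u" if "x \<in> E" "u \<in> V x" for x u
    unfolding P_def
    by (rule order_trans[OF close[OF that(1) x0 that(2)]]) (intro mult_right_mono small that x0, simp)
  have zero: "u = 0" if "x \<in> E" "u \<in> V x" "P u = 0" for x u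
    using near[OF that(1,2)] that(3) by simp
  \<comment> \<open>Of the length of \<open>y - x\<close>, at most \<open>15 / 24\<close> is lost by
    passing to \<open>V x\<close> and \<open>5 / 24\<close> by the tilt of \<open>V x\<close>; the
    remaining sixth is visible in the projection.\<close>
  have cone: "dist x y \<le> 6 * norm (P (y - x))" if xy: "x \<in> E" "y \<in> E" for x y
  proof -
    define p where "p = orth_proj (V x) (y - x)"
    have p: "p \<in> V x" "norm p \<le> norm (y - x)"
      unfolding p_def by (rule orth_proj[OF sV[OF xy(1)]], rule norm_orth_proj_le[OF sV[OF xy(1)]])
    have "norm ((y - x) - p) \<le> 3 * (K * dist x y powr \<alpha>) * dist x y"
      using flat[OF xy] by (cases "x = y") (simp_all add: p_def powr_add ac_simps)
    also have "\<dots> \<le> 3 * (5 / 24) * dist x y"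
      using small[OF xy] by (intro mult_right_mono mult_left_mono) auto
    finally have q: "norm ((y - x) - p) \<le> 15 / 24 * norm (y - x)"
      by (simp add: dist_norm norm_minus_commute)
    have "(y - x) = P (y - x) + ((y - x - p) - P (y - x - p)) + (p - P p)"
      by (simp add: linear_diff[OF linP])
    then have "norm (y - x) = norm (P (y - x) + ((y - x - p) - P (y - x - p)) + (p - P p))"
      by (rule arg_cong)
    also have "\<dots> \<le> norm (P (y - x)) + norm ((y - x - p) - P (y - x - p)) + norm (p - P p)"
      by (intro norm_triangle_mono order_refl)
    finally have "norm (y - x) \<le> norm (P (y - x)) + norm ((y - x - p) - P (y - x - p)) + norm (p - P p)" .
    moreover have "norm ((y - x - p) - P (y - x - p)) \<le> 15 / 24 * norm (y - x)"
      using normQ[of "y - x - p"] q by linarith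
    moreover have "norm (p - P p) \<le> 5 / 24 * norm (y - x)"
      using near[OF xy(1) p(1)] p(2) by simp
    ultimately have "norm (y - x) \<le> 6 * norm (P (y - x))" by linarith
    then show ?thesis by (simp add: dist_norm norm_minus_commute)
  qed
  \<comment> \<open>Equal dimensions make \<open>P\<close> an isomorphism from \<open>V x\<close>
    onto \<open>V x0\<close>. Composing its inverse with \<open>P\<close> makes the lift linear on
    the whole space, where the Whitney extension takes place.\<close>
  have "\<exists>J. linear J \<and> (\<forall>h. J h \<in> V x \<and> P (J h) = P h)" if x: "x \<in> E" for x
  proof -
    have inj: "inj_on P (V x)"
      using linear_injective_on_subspace_0[OF linP sV[OF x]] zero[OF x] by blast
    have "dim (P ` V x) = k"
      using dim_image_eq[OF linP, of "V x"] inj by (simp add: span_eq_iff[THEN iffD2, OF sV[OF x]] dV[OF x])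
    then have "P ` V x = V x0"
      by (intro subspace_dim_equal linear_subspace_image linP sV x x0) (use PV dV[OF x0] in auto)
    moreover obtain g where "range g \<subseteq> V x" "linear g" "\<forall>v\<in>P ` V x. P (g v) = v"
      using linear_exists_right_inverse_on[OF linP sV[OF x]] by blast
    ultimately show ?thesis
      by (intro exI[of _ "g \<circ> P"]) (use PV linP in \<open>auto intro: linear_compose\<close>)
  qed
  then obtain J where linJ: "\<And>x. x \<in> E \<Longrightarrow> linear (J x)"
    and JV: "\<And>x h. x \<in> E \<Longrightarrow> J x h \<in> V x" and PJ: "\<And>x h. x \<in> E \<Longrightarrow> P (J x h) = P h"
    by metis
  have J_eqI: "J x h = u" if "x \<in> E" "u \<in> V x" "P u = P h" for x u h
  proof -
    have "J x h - u = 0"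
      by (rule zero[OF that(1)])
        (use that in \<open>auto intro!: subspace_diff sV JV simp: linear_diff[OF linP] PJ\<close>)
    then show ?thesis by simp
  qed
  \<comment> \<open>Absorbing \<open>5 / 24\<close> of the left-hand side gives the factor
    \<open>24 / 19\<close>, rounded up to 2.\<close>
  have normJ: "norm (J x h) \<le> 2 * norm h" if "x \<in> E" for x h
    using near[OF that JV[OF that], of h] norm_triangle_ineq[of "J x h - P (J x h)" "P (J x h)"] normP[of h]
      norm_ge_zero[of h] unfolding PJ[OF that] diff_add_cancel by argo
  have J_diff: "norm (J y h - J x h) \<le> 6 * K * dist x y powr \<alpha> * norm h" if xy: "x \<in> E" "y \<in> E" for x y h
  proof -
    define u where "u = J x h"
    \<comment> \<open>The vector of \<open>V y\<close> nearest to \<open>u\<close> is fixed by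
      \<open>J y\<close>, so the two lifts differ only through the small vector
      \<open>u - u'\<close>.\<close>
    define u' where "u' = orth_proj (V y) u"
    have u': "u' \<in> V y" unfolding u'_def by (rule orth_proj[OF sV[OF xy(2)]])
    have "J y h = J y u"
      by (rule J_eqI[OF xy(2) JV[OF xy(2)]]) (simp add: PJ xy u_def)
    moreover have "J y u' = u'" by (rule J_eqI[OF xy(2) u' refl])
    ultimately have "J y h - J x h = J y (u - u') - (u - u')"
      by (simp add: linear_diff[OF linJ[OF xy(2)]] u_def)
    then have "norm (J y h - J x h) \<le> 3 * norm (u - u')"
      using norm_triangle_ineq4[of "J y (u - u')" "u - u'"] normJ[OF xy(2), of "u - u'"] by simp
    also have "\<dots> \<le> 3 * (K * dist x y powr \<alpha> * norm u)"
      unfolding u'_def u_def using close[OF xy JV[OF xy(1)]] by simp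
    also have "\<dots> \<le> 3 * (K * dist x y powr \<alpha> * (2 * norm h))"
      unfolding u_def using normJ[OF xy(1)] K by (intro mult_left_mono) auto
    finally show ?thesis by simp
  qed
  have J_taylor: "norm (y - x - J x (P (y - x))) \<le> 9 * K * dist x y powr (1 + \<alpha>)"
    if xy: "x \<in> E" "y \<in> E" for x y
  proof -
    define p where "p = orth_proj (V x) (y - x)"
    have p: "p \<in> V x" unfolding p_def by (rule orth_proj[OF sV[OF xy(1)]])
    have "P (P h) = P h" for h unfolding P_def
      by (rule orth_proj_eq_self[OF sV[OF x0]]) (rule orth_proj[OF sV[OF x0]])
    then have "J x (P (y - x)) = J x (y - x)"
      by (intro J_eqI[OF xy(1) JV[OF xy(1)]]) (simp add: PJ xy)
    moreover have "J x p = p" by (rule J_eqI[OF xy(1) p refl])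
    ultimately have eq: "y - x - J x (P (y - x)) = (y - x - p) - J x (y - x - p)"
      by (simp add: linear_diff[OF linJ[OF xy(1)]])
    have "norm (y - x - J x (P (y - x))) \<le> 3 * norm (y - x - p)"
      unfolding eq
      using norm_triangle_ineq4[of "y - x - p" "J x (y - x - p)"] normJ[OF xy(1), of "y - x - p"] by argo
    also have "\<dots> \<le> 3 * (3 * K * dist x y powr (1 + \<alpha>))"
      unfolding p_def using flat[OF xy] by simp
    finally show ?thesis by simp
  qed
  \<comment> \<open>With \<open>6 powr s \<le> 6 powr 2\<close>, one constant serves both exponents
    \<open>\<alpha>\<close> and \<open>1 + \<alpha>\<close>.\<close>
  have dist_powr: "dist x y powr s \<le> 36 * norm (P (y - x)) powr s" if "x \<in> E" "y \<in> E" "0 \<le> s" "s \<le> 2" for x y s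
  proof -
    have "dist x y powr s \<le> (6 * norm (P (y - x))) powr s"
      using cone[OF that(1,2)] that(3) by (intro powr_mono2) auto
    also have "\<dots> = 6 powr s * norm (P (y - x)) powr s" by (simp add: powr_mult)
    also have "\<dots> \<le> 6 powr 2 * norm (P (y - x)) powr s"
      using that(4) by (intro mult_right_mono powr_mono) auto
    finally show ?thesis by simp
  qed
  define \<sigma> where "\<sigma> = inv_into E P"
  have "inj_on P E"
  proof (rule inj_onI)
    fix x y assume "x \<in> E" "y \<in> E" "P x = P y"
    then show "x = y" using cone[of x y] by (simp add: linear_diff[OF linP])
  qed
  then have \<sigma>: "\<sigma> (P x) = x" if "x \<in> E" for x
    using that by (simp add: \<sigma>_def inv_into_f_f)
  \<comment> \<open>The constant 324 is \<open>9 * 36\<close> from the Taylor condition; the Hoelder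
    condition needs only \<open>6 * 36\<close>.\<close>
  obtain F M where F: "\<And>a. a \<in> P ` E \<Longrightarrow> F a = \<sigma> a"
    and sd: "\<And>x v. norm (F (x + v) + F (x - v) - 2 *\<^sub>R F x) \<le> M * norm v powr (1 + \<alpha>)"
    and bdd: "\<And>R. bounded (F ` cball 0 R)"
  proof (rule whitney_C1_alpha_extension[of \<alpha> "324 * K" "P ` E" "\<lambda>a. J (\<sigma> a)" \<sigma>])
    show "linear (J (\<sigma> a))" if "a \<in> P ` E" for a
      using that by (auto simp: \<sigma> linJ)
    show "norm (\<sigma> b - \<sigma> a - J (\<sigma> a) (b - a)) \<le> 324 * K * norm (b - a) powr (1 + \<alpha>)"
      if ab: "a \<in> P ` E" "b \<in> P ` E" for a b
    proof -
      obtain x y where xy: "x \<in> E" "a = P x" "y \<in> E" "b = P y" using ab by blast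
      have "norm (\<sigma> b - \<sigma> a - J (\<sigma> a) (b - a)) \<le> 9 * K * dist x y powr (1 + \<alpha>)"
        using J_taylor[OF xy(1,3)] by (simp add: xy \<sigma> linear_diff[OF linP])
      also have "\<dots> \<le> 9 * K * (36 * norm (P (y - x)) powr (1 + \<alpha>))"
        using dist_powr[OF xy(1,3), of "1 + \<alpha>"] K \<alpha> by (intro mult_left_mono) auto
      finally show ?thesis by (simp add: xy linear_diff[OF linP])
    qed
    show "norm (J (\<sigma> b) v - J (\<sigma> a) v) \<le> 324 * K * norm (b - a) powr \<alpha> * norm v"
      if ab: "a \<in> P ` E" "b \<in> P ` E" for a b v
    proof -
      obtain x y where xy: "x \<in> E" "a = P x" "y \<in> E" "b = P y" using ab by blast
      have "norm (J (\<sigma> b) v - J (\<sigma> a) v) \<le> 6 * K * dist x y powr \<alpha> * norm v"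
        using J_diff[OF xy(1,3)] by (simp add: xy \<sigma>)
      also have "\<dots> \<le> 6 * K * (36 * norm (P (y - x)) powr \<alpha>) * norm v"
        using dist_powr[OF xy(1,3), of \<alpha>] K \<alpha> by (intro mult_left_mono mult_right_mono) auto
      also have "\<dots> = 216 * (K * norm (b - a) powr \<alpha> * norm v)"
        by (simp add: xy linear_diff[OF linP])
      also have "\<dots> \<le> 324 * (K * norm (b - a) powr \<alpha> * norm v)"
        using K by (intro mult_right_mono) auto
      finally show ?thesis by simp
    qed
  qed (use \<alpha> K in auto)
  \<comment> \<open>Off the image of \<open>E\<close> the identity \<open>P (F z) = z\<close> may
    fail, so only the component of \<open>F\<close> normal to \<open>V x0\<close> is kept. Removing
    the tangential part is linear and does not increase norms, so the second difference bound
    survives.\<close>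
  define f where "f z = F z - P (F z)" for z
  have "C1_holder_on \<alpha> (V x0) f"
  proof (rule C1_holder_on_second_difference[OF \<alpha>(1)])
    show "norm (f (x + v) + f (x - v) - 2 *\<^sub>R f x) \<le> M * norm v powr (1 + \<alpha>)" for x v
    proof -
      define w where "w = F (x + v) + F (x - v) - 2 *\<^sub>R F x"
      have "f (x + v) + f (x - v) - 2 *\<^sub>R f x = w - P w"
        by (simp add: f_def w_def linear_add[OF linP] linear_diff[OF linP] linear_scale[OF linP] scaleR_2)
      then show ?thesis using normQ[of w] sd[of x v] by (simp add: w_def)
    qed
    show "bounded (f ` cball 0 R)" for R
      using bdd[of R] normQ unfolding bounded_iff f_def by (auto intro: order_trans)
  qed
  moreover have "f ` V x0 \<subseteq> orthogonal_comp (V x0)"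
    unfolding f_def P_def using orth_proj(2)[OF sV[OF x0]] by blast
  ultimately have "C1_holder_graph k \<alpha> {v + f v | v. v \<in> V x0}"
    unfolding C1_holder_graph_def using V[OF x0] by blast
  moreover have "E \<subseteq> {v + f v | v. v \<in> V x0}"
  proof
    fix x assume x: "x \<in> E"
    then have "x = P x + f (P x)" by (simp add: f_def F \<sigma>)
    then show "x \<in> {v + f v | v. v \<in> V x0}" using PV by blast
  qed
  ultimately show ?thesis by blast
qed

section \<open>The smallness condition and the covering theorem\<close>

text \<open>The base of the power bounding \<open>r\<close> is at least \<open>24 * lam\<close> and
  at least \<open>8 * C\<close>, so \<open>5 / 24\<close> of it dominates both entries of the
  maximum; its exponent makes \<open>r powr \<alpha>\<close> at most the reciprocal of that
  base.\<close>

lemma slope_bound: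
  fixes C \<delta> M lam \<omega> \<alpha> r :: real
  assumes "0 < \<alpha>" "0 < lam" "0 < \<delta>" "0 < M" "0 < \<omega>" "1 \<le> n" "0 \<le> r"
    and C: "C = (20 ^ (n + 1) * 2 * real n * M * lam) / (\<delta> * \<omega>)"
    and r: "r \<le> (4 * lam * (2 + 4 powr (1 + \<alpha>)) + 8 * C) powr (- 1 / \<alpha>)"
  shows "max (5 * lam) (10 ^ (n + 1) * M * lam / (\<delta> * \<omega>)) * r powr \<alpha> \<le> 5 / 24"
proof -
  define X where "X = M * lam / (\<delta> * \<omega>)"
  have X: "0 < X" using assms by (simp add: X_def)
  define A where "A = 4 * lam * (2 + 4 powr (1 + \<alpha>)) + 8 * C"
  have "(10::real) ^ (n + 1) * 1 \<le> 20 ^ (n + 1) * (2 * real n)"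
    using assms(6) by (intro mult_mono power_mono) auto
  from mult_right_mono[OF this less_imp_le[OF X]] have CX: "10 ^ (n + 1) * X \<le> C"
    by (simp add: C X_def mult.assoc)
  have C0: "0 < C" using CX X by (smt (verit) zero_less_mult_iff zero_less_power)
  have "(4::real) powr 1 \<le> 4 powr (1 + \<alpha>)" using assms(1) by (intro powr_mono) auto
  then have "4 * lam * 6 \<le> 4 * lam * (2 + 4 powr (1 + \<alpha>))"
    using assms(2) by (intro mult_left_mono) auto
  then have A: "24 * lam \<le> A" "8 * C \<le> A" using C0 assms(2) unfolding A_def by argo+
  have A0: "0 < A" using A(1) assms(2) by linarith
  have "r powr \<alpha> \<le> (A powr (- 1 / \<alpha>)) powr \<alpha>"
    using r assms by (intro powr_mono2) (auto simp: A_def)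
  also have "\<dots> = A powr (- 1)" unfolding powr_powr using assms(1) by simp
  also have "\<dots> = 1 / A" using A0 by (rule powr_neg_one)
  finally have rA: "r powr \<alpha> \<le> 1 / A" .
  have "max (5 * lam) (10 ^ (n + 1) * M * lam / (\<delta> * \<omega>)) \<le> 5 / 24 * A"
    using A CX C0 by (simp add: X_def mult.assoc)
  from mult_mono[OF this rA] A0 have "max (5 * lam) (10 ^ (n + 1) * M * lam / (\<delta> * \<omega>)) * r powr \<alpha> \<le> 5 / 24 * A * (1 / A)"
    by simp
  then show ?thesis using A0 by simp
qed

theorem proposition1p5:
  fixes E :: "(real ^ 'n) set"
    and k :: nat
    and \<alpha> lam \<delta> M \<epsilon>\<^sub>0 \<omega>\<^sub>n C r\<^sub>1 :: real
  assumes "1 \<le> k" and "k \<le> CARD('n) - 1"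
    and "0 < \<alpha>" and "\<alpha> \<le> 1"
    and "0 < lam" and "0 < \<delta>" and "0 < M"
    and eps0: "\<epsilon>\<^sub>0 = 2 ^ k * 240 powi (- int k - 1)"
    and omega: "\<omega>\<^sub>n = measure lebesgue (cball (0 :: real ^ 'n) 1)"
    and C: "C = (20 ^ (CARD('n) + 1) * 2 * real CARD('n) * M * lam) / (\<delta> * \<omega>\<^sub>n)"
    and r1: "r\<^sub>1 = (4 * lam * (2 + 4 powr (1 + \<alpha>)) + 8 * C) powr (- 1 / \<alpha>)"
    and borel: "E \<in> sets borel"
    and regular: "\<forall>x\<in>E. \<forall>r. 0 < r \<and> r \<le> diameter E \<longrightarrow>
       ennreal (\<delta> * r ^ k) \<le> hausdorff_measure k (E \<inter> cball x r) \<and>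
       hausdorff_measure k (E \<inter> cball x r) \<le> ennreal (M * r ^ k)"
    and paraboloids: "\<forall>x\<in>E. \<exists>V. linear_plane k V \<and>
       (\<forall>r. 0 < r \<and> r \<le> diameter E \<longrightarrow>
          hausdorff_measure k ((E \<inter> cball x r) - paraboloid \<alpha> x V lam) < ennreal (\<epsilon>\<^sub>0 * \<delta> * r ^ k))"
    (* together these say diam E <= r_1: the library's diameter is meaningful only on bounded sets *)
    and "bounded E" and "diameter E \<le> r\<^sub>1"
  shows "\<exists>G. C1_holder_graph k \<alpha> G \<and> E \<subseteq> G"
proof (cases "E = {}")
  case True
  \<comment> \<open>Even the empty set has to lie in some graph: the zero map over any
    \<open>k\<close>-plane provides one.\<close>
  have "k \<le> dim (UNIV :: (real ^ 'n) set)" using assms(2) by simp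
  then obtain V :: "(real ^ 'n) set" where V: "subspace V" "dim V = k"
    by (rule choose_subspace_of_subspace)
  have "C1_holder_on \<alpha> V (\<lambda>_. 0 :: real ^ 'n)"
    by (rule C1_holder_on_second_difference[OF assms(3), of _ 0]) (auto simp: image_constant_conv)
  then have "C1_holder_graph k \<alpha> {v + 0 | v. v \<in> V}"
    unfolding C1_holder_graph_def linear_plane_def using V
    by (intro exI[of _ V] exI[of _ "\<lambda>_. 0"]) (auto simp: subspace_0 subspace_orthogonal_comp)
  then show ?thesis using True by blast
next
  case False
  define d where "d = diameter E"
  have dist_le: "dist x y \<le> d" if "x \<in> E" "y \<in> E" for x y
    unfolding d_def using diameter_bounded_bound[OF \<open>bounded E\<close> that] .
  obtain V where V: "\<And>x. x \<in> E \<Longrightarrow> linear_plane k (V x)"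
    and bad_d: "\<And>x r. x \<in> E \<Longrightarrow> 0 < r \<Longrightarrow> r \<le> d \<Longrightarrow>
      hausdorff_measure k ((E \<inter> cball x r) - paraboloid \<alpha> x (V x) lam) \<le> ennreal (\<epsilon>\<^sub>0 * \<delta> * r ^ k)"
    using paraboloids unfolding d_def by (metis less_imp_le)
  \<comment> \<open>The assumptions stop at radius \<open>d\<close>, but the radius
    \<open>2 * dist x y\<close> may exceed it. Balls beyond the diameter capture nothing new, so
    upper bounds extend to all larger radii.\<close>
  have large_ball: "E \<inter> cball x r = E \<inter> cball x d" if "x \<in> E" "d \<le> r" for x r
    using dist_le[OF that(1)] that(2) by force
  have "- int k - 1 = - int (k + 1)" by simp
  with eps0 have "\<epsilon>\<^sub>0 = 2 ^ k * 240 powi (- int (k + 1))" by (simp only:)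
  then have e: "\<epsilon>\<^sub>0 = 2 ^ k / 240 ^ (k + 1)"
    unfolding power_int_minus power_int_of_nat by (simp only: divide_inverse)
  then have "0 \<le> \<epsilon>\<^sub>0" by simp
  \<comment> \<open>The target \<open>120 * 240 ^ k\<close> is half the denominator of
    \<open>\<epsilon>\<^sub>0\<close>.\<close>
  have "(2::real) ^ k * (1 + 2 ^ k) \<le> 2 ^ k * (2 * 2 ^ k)"
    by (intro mult_left_mono) auto
  also have "\<dots> = 2 * (2 * 2) ^ k" by (simp only: power_mult_distrib ac_simps)
  also have "\<dots> \<le> 120 * 240 ^ k" by (intro mult_mono power_mono) auto
  finally have "\<epsilon>\<^sub>0 * (1 + 2 ^ k) \<le> 1 / 2" by (simp add: e field_simps)
  note \<epsilon> = \<open>0 \<le> \<epsilon>\<^sub>0\<close> this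
  \<comment> \<open>The condition \<open>0 < d\<close> is available once \<open>E\<close> contains
    two points; the bound is applied only to pairs of distinct points.\<close>
  have upper: "hausdorff_measure k (E \<inter> cball z s) \<le> ennreal (M * s ^ k)"
    if z: "z \<in> E" "0 < s" "0 < d" for z s
  proof (cases "s \<le> d")
    case True
    then show ?thesis using regular z unfolding d_def by blast
  next
    case False
    then have "hausdorff_measure k (E \<inter> cball z s) \<le> ennreal (M * d ^ k)"
      using regular z large_ball[OF z(1), of s] unfolding d_def by simp
    also have "\<dots> \<le> ennreal (M * s ^ k)"
      using False \<open>0 < M\<close> z by (intro ennreal_leI mult_left_mono power_mono) auto
    finally show ?thesis .
  qed
  have bad: "hausdorff_measure k ((E \<inter> cball x r) - paraboloid \<alpha> x (V x) lam) \<le> ennreal (\<epsilon>\<^sub>0 * \<delta> * r ^ k)"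
    if x: "x \<in> E" "0 < r" "0 < d" for x r
  proof (cases "r \<le> d")
    case True
    then show ?thesis using bad_d x by blast
  next
    case False
    then have "hausdorff_measure k ((E \<inter> cball x r) - paraboloid \<alpha> x (V x) lam) \<le> ennreal (\<epsilon>\<^sub>0 * \<delta> * d ^ k)"
      using bad_d[OF x(1,3)] large_ball[OF x(1), of r] by simp
    also have "\<dots> \<le> ennreal (\<epsilon>\<^sub>0 * \<delta> * r ^ k)"
      using False \<epsilon> \<open>0 < \<delta>\<close> x by (intro ennreal_leI mult_left_mono power_mono) auto
    finally show ?thesis .
  qed
  have \<omega>: "0 < \<omega>\<^sub>n" unfolding omega using content_cball_pos[of 1 "0 :: real ^ 'n"] by simp
  define K where "K = max (5 * lam) (10 ^ (CARD('n) + 1) * M * lam / (\<delta> * \<omega>\<^sub>n))"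
  have K: "5 * lam \<le> K" "0 \<le> K" using \<open>0 < lam\<close> by (auto simp: K_def le_max_iff_disj)
  have *: "(\<exists>z. dist x z \<le> dist x y \<and> z \<in> paraboloid \<alpha> x (V x) lam \<and> z \<in> paraboloid \<alpha> y (V y) lam) \<and>
      (\<forall>u\<in>V x. norm (u - orth_proj (V y) u) \<le> K * dist x y powr \<alpha> * norm u)"
    if xy: "x \<in> E" "y \<in> E" "x \<noteq> y" for x y
  proof -
    have r: "0 < dist x y" "0 < d" "dist x y \<le> d"
      using xy dist_le[OF xy(1,2)] by (auto intro: less_le_trans[of 0 "dist x y"])
    have "ennreal (\<delta> * dist x y ^ k) \<le> hausdorff_measure k (E \<inter> cball x (dist x y))"
      using regular xy r unfolding d_def by blast
    moreover have "hausdorff_measure k ((E \<inter> cball x (dist x y)) - paraboloid \<alpha> x (V x) lam)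
        \<le> ennreal (\<epsilon>\<^sub>0 * \<delta> * dist x y ^ k)"
      using bad[OF xy(1) r(1,2)] .
    moreover have "hausdorff_measure k ((E \<inter> cball y (2 * dist x y)) - paraboloid \<alpha> y (V y) lam)
        \<le> ennreal (\<epsilon>\<^sub>0 * \<delta> * (2 * dist x y) ^ k)"
      by (rule bad[OF xy(2) _ r(2)]) (use r(1) in simp)
    moreover have "\<And>z s. z \<in> E \<Longrightarrow> 0 < s \<Longrightarrow> hausdorff_measure k (E \<inter> cball z s) \<le> ennreal (M * s ^ k)"
      using upper r(2) by blast
    ultimately show ?thesis
      using planes_close[OF \<open>1 \<le> k\<close> \<open>0 < \<alpha>\<close> \<open>\<alpha> \<le> 1\<close> \<open>0 < lam\<close> \<open>0 < \<delta>\<close> \<open>0 < M\<close> V[OF xy(1)] V[OF xy(2)]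
          r(1) refl \<epsilon>(2,1), of E]
      unfolding K_def omega by blast
  qed
  have sV: "subspace (V x)" if "x \<in> E" for x using V[OF that] by (simp add: linear_plane_def)
  have close: "norm (u - orth_proj (V y) u) \<le> K * dist x y powr \<alpha> * norm u"
    if "x \<in> E" "y \<in> E" "u \<in> V x" for x y u
    using that *[OF that(1,2)] orth_proj_eq_self[OF sV] by (cases "x = y") auto
  show ?thesis
  proof (rule C1_holder_graph_of_close_planes[OF \<open>0 < \<alpha>\<close> \<open>\<alpha> \<le> 1\<close> K(2) False V close])
    show "K * dist x y powr \<alpha> \<le> 5 / 24" if "x \<in> E" "y \<in> E" for x y
      unfolding K_def
      by (rule slope_bound[OF _ _ _ _ _ _ _ C])
        (use assms \<omega> order_trans[OF dist_le[OF that]] in \<open>auto simp: d_def r1 Suc_le_eq\<close>)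
    show "norm ((y - x) - orth_proj (V x) (y - x)) \<le> 3 * K * dist x y powr (1 + \<alpha>)"
      if xy: "x \<in> E" "y \<in> E" for x y
    proof (cases "x = y")
      case True
      then show ?thesis using linear_0[OF linear_orth_proj[OF sV[OF xy(1)]]] by simp
    next
      case False
      define r where "r = dist x y"
      have r: "0 < r" using False by (simp add: r_def)
      \<comment> \<open>The common point \<open>z\<close> links the two planes: \<open>z - x\<close>
        is near \<open>V x\<close>, \<open>z - y\<close> is near \<open>V y\<close>, and the
        \<open>V y\<close> part of \<open>z - y\<close> is near \<open>V x\<close> because the
        planes are close.\<close>
      obtain z where z: "dist x z \<le> r" "z \<in> paraboloid \<alpha> x (V x) lam" "z \<in> paraboloid \<alpha> y (V y) lam"
        using *[OF xy False] unfolding r_def by blast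
      define p where "p = orth_proj (V y) (z - y)"
      have p: "p \<in> V y" "norm p \<le> norm (z - y)"
        unfolding p_def by (rule orth_proj[OF sV[OF xy(2)]], rule norm_orth_proj_le[OF sV[OF xy(2)]])
      have yz: "dist y z \<le> 2 * r"
        using z(1) dist_triangle[of y z x] by (simp add: r_def dist_commute)
      define t where "t = r powr (1 + \<alpha>)"
      have t: "0 \<le> t" by (simp add: t_def)
      have zx: "norm ((z - x) - orth_proj (V x) (z - x)) \<le> lam * t"
        unfolding t_def by (rule paraboloid_cball) (use z sV xy assms in auto)
      have "norm ((z - y) - p) \<le> lam * (2 * r) powr (1 + \<alpha>)"
        unfolding p_def by (rule paraboloid_cball) (use z yz sV xy assms in auto)
      also have "\<dots> = lam * (2 powr (1 + \<alpha>) * t)" using r by (simp add: powr_mult t_def)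
      also have "\<dots> \<le> lam * (2 powr 2 * t)"
        using assms t by (intro mult_left_mono mult_right_mono powr_mono) auto
      finally have zy: "norm ((z - y) - p) \<le> 4 * (lam * t)" by simp
      have "norm (p - orth_proj (V x) p) \<le> K * r powr \<alpha> * norm p"
        using close[OF xy(2,1) p(1)] by (simp add: r_def dist_commute)
      also have "\<dots> \<le> K * r powr \<alpha> * (2 * r)"
        using p(2) yz K by (intro mult_left_mono) (auto simp: dist_norm norm_minus_commute)
      also have "\<dots> = 2 * (K * t)" using r by (simp add: t_def powr_add)
      finally have pK: "norm (p - orth_proj (V x) p) \<le> 2 * (K * t)" .
      \<comment> \<open>Since \<open>y - x\<close> is the difference of \<open>z - x\<close> and
        \<open>z - y\<close>, the projections of \<open>z - x\<close> and of \<open>p\<close> to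
        \<open>V x\<close> give a point of \<open>V x\<close> close to \<open>y - x\<close>.\<close>
      define q where "q = orth_proj (V x) (z - x) - orth_proj (V x) p"
      have "q \<in> V x" unfolding q_def by (intro subspace_diff orth_proj sV xy)
      then have "norm ((y - x) - orth_proj (V x) (y - x)) \<le> norm ((y - x) - q)"
        by (rule norm_diff_orth_proj_le[OF sV[OF xy(1)]])
      also have "(y - x) - q = ((z - x) - orth_proj (V x) (z - x)) - ((z - y) - p) - (p - orth_proj (V x) p)"
        by (simp add: q_def)
      also have "norm \<dots> \<le> lam * t + 4 * (lam * t) + 2 * (K * t)"
        by (intro norm_diff_le_add zx zy pK)
      \<comment> \<open>The two slab errors add up to \<open>5 * lam * t\<close>, which is at most
        \<open>K * t\<close> by the first entry of the maximum in \<open>K\<close>.\<close>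
      also have "\<dots> \<le> 3 * (K * t)"
        using mult_right_mono[OF K(1) t] by simp
      finally show ?thesis by (simp add: t_def r_def)
    qed
  qed
qed

end
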